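(* Let $n\ge2$, $1\le m<n$, $k\ge2$ be integers, let $\Sigma\subset\mathbb{R}^n$ be a compact $m$-dimensional $C^k$ submanifold and $\varepsilon>0$. Then for every $R\ge C_{\Sigma,\varepsilon}$ there is an $m$-dimensional $C^k$ submanifold $\Sigma'_R$ within $\varepsilon$ of $\Sigma$ in the $C^k$ topology which contains at least $c_{\Sigma,\varepsilon}R^{\frac{mn}{m+k(n-m)}}$ points of the lattice $(\tfrac1R\mathbb{Z})^n$, where $C_{\Sigma,\varepsilon},c_{\Sigma,\varepsilon}>0$ depend only on $\Sigma,\varepsilon$ (and $n,m,k$). *)

theory Defs
  imports "HOL-Analysis.Analysis"
begin

text \<open>Partial derivative of a map on real vectors in coordinate direction i
 (meaningful where the map is differentiable).\<close>
definition partial_deriv :: "'n::finite \<Rightarrow> (real^'n \<Rightarrow> real^'m) \<Rightarrow> real^'n \<Rightarrow> real^'m" where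
  "partial_deriv i f x = frechet_derivative f (at x) (axis i 1)"

fun Ck_on :: "nat \<Rightarrow> (real^'n::finite) set \<Rightarrow> (real^'n \<Rightarrow> real^'m::finite) \<Rightarrow> bool" where
  "Ck_on 0 U f = continuous_on U f"
| "Ck_on (Suc k) U f =
     (continuous_on U f \<and> (\<forall>x\<in>U. f differentiable (at x)) \<and>
      (\<forall>i. Ck_on k U (partial_deriv i f)))"

fun iter_partial :: "'n::finite list \<Rightarrow> (real^'n \<Rightarrow> real^'m) \<Rightarrow> real^'n \<Rightarrow> real^'m" where
  "iter_partial [] f = f"
| "iter_partial (i # is) f = iter_partial is (partial_deriv i f)"

definition Ck_diffeo_on :: "nat \<Rightarrow> (real^'n::finite) set \<Rightarrow> (real^'n) set \<Rightarrow> (real^'n \<Rightarrow> real^'n) \<Rightarrow> bool" where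
  "Ck_diffeo_on k U V \<phi> \<longleftrightarrow> open U \<and> open V \<and> Ck_on k U \<phi> \<and> inj_on \<phi> U \<and> \<phi> ` U = V \<and>
      Ck_on k V (inv_into U \<phi>)"

definition Ck_submanifold :: "nat \<Rightarrow> nat \<Rightarrow> (real^'n::finite) set \<Rightarrow> bool" where
  "Ck_submanifold k m S \<longleftrightarrow>
     (\<forall>p\<in>S. \<exists>U V \<phi> L. p \<in> U \<and> Ck_diffeo_on k U V \<phi> \<and> subspace L \<and> dim L = m \<and>
                  \<phi> ` (U \<inter> S) = V \<inter> L)"

text \<open>S' is within eps of S in the C^k topology: S' is the image of S under a
 C^k diffeomorphism Phi of R^n whose C^k distance to the identity (sup over R^n of all
 partial derivatives of Phi - id of order 0..k) is less than eps.\<close>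
definition Ck_close :: "nat \<Rightarrow> real \<Rightarrow> (real^'n::finite) set \<Rightarrow> (real^'n) set \<Rightarrow> bool" where
  "Ck_close k eps S S' \<longleftrightarrow>
     (\<exists>\<Phi> \<delta>. \<delta> < eps \<and> Ck_diffeo_on k UNIV UNIV \<Phi> \<and> S' = \<Phi> ` S \<and>
        (\<forall>is x. length is \<le> k \<longrightarrow> norm (iter_partial is (\<lambda>y. \<Phi> y - y) x) \<le> \<delta>))"

definition scaled_lattice :: "real \<Rightarrow> (real^'n::finite) set" where
  "scaled_lattice R = {x. \<forall>i. R * x $ i \<in> \<int>}"

end

theory Submission
  imports Defs
begin

text \<open>Some coordinate projection of \<open>\<Sigma>\<close> onto \<open>\<real>\<^sup>I\<close>, \<open>card I = m\<close>, contains a cube; call the other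
coordinates \<open>J\<close>. All perturbations are shears \<open>x \<mapsto> x + G (x\<^sub>I)\<close> with \<open>G\<close> valued in \<open>\<real>\<^sup>J\<close>, so their
inverses are explicit. The cube is cut into cells with \<open>w\<^sup>m\<close> candidate lattice points of \<open>\<real>\<^sup>I\<close> each.
Over a candidate \<open>q\<close> the point of \<open>\<Sigma>\<close> becomes a lattice point after a bump of height \<open>1/(LR)\<close> as
soon as its \<open>J\<close>-coordinates are within \<open>1/(LR)\<close> of the lattice. Adding a random translation of size
\<open>1/R\<close> and a random small multiple of \<open>sin (x\<^sub>l - c\<^sub>l)\<close> in every \<open>l \<in> I\<close> makes these events almost
pairwise independent of probability \<open>L\<^sup>-\<^sup>d\<close>, \<open>d = n - m\<close>, so if \<open>L\<^sup>d\<close> is comparable to \<open>w\<^sup>m\<close>, a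
second moment estimate yields a positive proportion of cells with a good candidate. The bumps have radius
about \<open>w/R\<close>; they are small in \<open>C\<^sup>k\<close> if \<open>L w\<^sup>k\<close> dominates \<open>R\<^bsup>k-1\<^esup>\<close>, which leads to \<open>w\<close> of order
\<open>R\<^bsup>(k-1)d/(kd+m)\<^esup>\<close> and to about \<open>(R/w)\<^sup>m\<close> lattice points.\<close>

subsection \<open>Calculus of \<open>C\<^sup>k\<close> maps\<close>

lemma partial_deriv_eqI:
  "(f has_derivative f') (at x) \<Longrightarrow> partial_deriv i f x = f' (axis i 1)"
  unfolding partial_deriv_def by (metis frechet_derivative_at)

lemma partial_deriv_cong:
  assumes "open U" "x \<in> U" "\<And>y. y \<in> U \<Longrightarrow> f y = g y"
  shows "partial_deriv i f x = partial_deriv i g x"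
proof -
  have "(f has_derivative f') (at x) \<longleftrightarrow> (g has_derivative f') (at x)" for f'
    using has_derivative_transform_within_open[of f f' x UNIV U g]
      has_derivative_transform_within_open[of g f' x UNIV U f] assms by auto
  then show ?thesis
    unfolding partial_deriv_def frechet_derivative_def by simp
qed

lemma partial_deriv_const [simp]: "partial_deriv i (\<lambda>x. c) = (\<lambda>x. 0)"
  by (simp add: partial_deriv_def fun_eq_iff)

lemma partial_deriv_linear: "linear f \<Longrightarrow> partial_deriv i f = (\<lambda>x. f (axis i 1))"
  by (intro ext partial_deriv_eqI linear_imp_has_derivative)

lemma partial_deriv_add:
  assumes "f differentiable (at x)" "g differentiable (at x)"
  shows "partial_deriv i (\<lambda>x. f x + g x) x = partial_deriv i f x + partial_deriv i g x"
  unfolding partial_deriv_def[of i f] partial_deriv_def[of i g]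
  by (intro partial_deriv_eqI has_derivative_add) (use assms frechet_derivative_works in blast)+

lemma has_derivative_component_scaleR:
  fixes f :: "real^'a::finite \<Rightarrow> real^'b::finite" and h :: "real^'a \<Rightarrow> real^'c::finite"
  assumes "(f has_derivative f') (at x)" "(h has_derivative h') (at x)"
  shows "((\<lambda>x. f x $ j *\<^sub>R h x) has_derivative (\<lambda>y. f x $ j *\<^sub>R h' y + f' y $ j *\<^sub>R h x)) (at x)"
  by (rule has_derivative_scaleR[OF _ assms(2)])
     (rule bounded_linear.has_derivative[OF bounded_linear_vec_nth assms(1)])

lemma differentiable_component_scaleR:
  fixes f :: "real^'a::finite \<Rightarrow> real^'b::finite" and h :: "real^'a \<Rightarrow> real^'c::finite"
  assumes "f differentiable (at x)" "h differentiable (at x)"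
  shows "(\<lambda>x. f x $ j *\<^sub>R h x) differentiable (at x)"
  using assms has_derivative_component_scaleR unfolding differentiable_def by blast

lemma partial_deriv_component_scaleR:
  fixes f :: "real^'a::finite \<Rightarrow> real^'b::finite" and h :: "real^'a \<Rightarrow> real^'c::finite"
  assumes "f differentiable (at x)" "h differentiable (at x)"
  shows "partial_deriv i (\<lambda>x. f x $ j *\<^sub>R h x) x
    = f x $ j *\<^sub>R partial_deriv i h x + partial_deriv i f x $ j *\<^sub>R h x"
  unfolding partial_deriv_def[of i f] partial_deriv_def[of i h]
  by (intro partial_deriv_eqI has_derivative_component_scaleR)
     (use assms frechet_derivative_works in blast)+

lemma linear_axis_expansion:
  fixes f :: "real^'a::finite \<Rightarrow> 'b::real_vector"
  assumes "linear f"
  shows "f y = (\<Sum>j\<in>UNIV. y $ j *\<^sub>R f (axis j 1))"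
proof -
  have "f y = f (\<Sum>j\<in>UNIV. y $ j *\<^sub>R axis j 1)"
    using basis_expansion[of y] by (simp add: scalar_mult_eq_scaleR)
  then show ?thesis by (simp add: linear_sum[OF assms] linear_scale[OF assms])
qed

lemma partial_deriv_compose:
  assumes f: "f differentiable (at (g x))" and g: "g differentiable (at x)"
  shows "partial_deriv i (\<lambda>x. f (g x)) x
    = (\<Sum>j\<in>UNIV. partial_deriv i g x $ j *\<^sub>R partial_deriv j f (g x))"
proof -
  have "((\<lambda>x. f (g x)) has_derivative
      (\<lambda>y. frechet_derivative f (at (g x)) (frechet_derivative g (at x) y))) (at x)"
    using has_derivative_compose[of g _ x UNIV f] f g by (auto simp: frechet_derivative_works)
  then have "partial_deriv i (\<lambda>x. f (g x)) x
      = frechet_derivative f (at (g x)) (frechet_derivative g (at x) (axis i 1))"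
    by (rule partial_deriv_eqI)
  then show ?thesis
    unfolding linear_axis_expansion[OF linear_frechet_derivative[OF f],
        of "frechet_derivative g (at x) (axis i 1)"]
    by (simp add: partial_deriv_def)
qed

lemma Ck_on_Suc_iff:
  "Ck_on (Suc k) U f \<longleftrightarrow> (\<forall>x\<in>U. f differentiable (at x)) \<and> (\<forall>i. Ck_on k U (partial_deriv i f))"
  using differentiable_imp_continuous_on[of f U]
  by (auto simp: differentiable_on_def differentiable_at_withinI)

declare Ck_on.simps(2) [simp del]

lemma Ck_on_cong:
  assumes "open U" "\<And>y. y \<in> U \<Longrightarrow> f y = g y" "Ck_on k U f"
  shows "Ck_on k U g"
  using assms(2,3)
proof (induction k arbitrary: f g)
  case 0
  then show ?case using continuous_on_cong[of U U f g] by auto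
next
  case (Suc k)
  have "g differentiable (at x)" if "x \<in> U" for x
    using Suc.prems that has_derivative_transform_within_open[of f _ x UNIV U g] assms(1)
    by (auto simp: differentiable_def Ck_on_Suc_iff) blast
  moreover have "Ck_on k U (partial_deriv i g)" for i
    by (rule Suc.IH[of "partial_deriv i f"])
       (use Suc.prems partial_deriv_cong[OF assms(1), of _ f g] in \<open>auto simp: Ck_on_Suc_iff\<close>)
  ultimately show ?case by (simp add: Ck_on_Suc_iff)
qed

lemma Ck_on_imp_continuous_on: "Ck_on k U f \<Longrightarrow> continuous_on U f"
  by (cases k) (auto simp: Ck_on.simps(2))

lemma Ck_on_imp_differentiable: "Ck_on k U f \<Longrightarrow> k \<ge> 1 \<Longrightarrow> x \<in> U \<Longrightarrow> f differentiable (at x)"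
  by (cases k) (auto simp: Ck_on_Suc_iff)

lemma Ck_on_SucD: "Ck_on (Suc k) U f \<Longrightarrow> Ck_on k U f"
proof (induction k arbitrary: f)
  case 0
  then show ?case by (simp add: Ck_on_imp_continuous_on)
qed (metis Ck_on_Suc_iff)

lemma Ck_on_subset: "Ck_on k U f \<Longrightarrow> V \<subseteq> U \<Longrightarrow> Ck_on k V f"
  by (induction k arbitrary: f) (auto intro: continuous_on_subset simp: Ck_on_Suc_iff)

lemma Ck_on_const: "Ck_on k U (\<lambda>x. c)"
  by (induction k arbitrary: c) (simp_all add: Ck_on_Suc_iff)

lemma Ck_on_linear: "linear f \<Longrightarrow> Ck_on k U f"
  by (cases k)
     (auto simp: Ck_on_Suc_iff partial_deriv_linear Ck_on_const linear_continuous_on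
       linear_imp_differentiable linear_conv_bounded_linear)

lemma Ck_on_add:
  assumes "open U"
  shows "Ck_on k U f \<Longrightarrow> Ck_on k U g \<Longrightarrow> Ck_on k U (\<lambda>x. f x + g x)"
proof (induction k arbitrary: f g)
  case 0
  then show ?case by (simp add: continuous_on_add)
next
  case (Suc k)
  have "Ck_on k U (partial_deriv i (\<lambda>x. f x + g x))" for i
    by (rule Ck_on_cong[OF assms partial_deriv_add[symmetric] Suc.IH])
       (use Suc.prems in \<open>auto simp: Ck_on_Suc_iff\<close>)
  then show ?case using Suc.prems by (simp add: Ck_on_Suc_iff)
qed

lemma Ck_on_sum:
  assumes "open U" "finite S" "\<And>t. t \<in> S \<Longrightarrow> Ck_on k U (f t)"
  shows "Ck_on k U (\<lambda>x. \<Sum>t\<in>S. f t x)"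
  using assms(2,3) by (induction S) (auto intro: Ck_on_const Ck_on_add[OF assms(1)])

lemma Ck_on_component_scaleR:
  assumes "open U"
  shows "Ck_on k U f \<Longrightarrow> Ck_on k U h \<Longrightarrow> Ck_on k U (\<lambda>x. f x $ j *\<^sub>R h x)"
proof (induction k arbitrary: f h)
  case 0
  then show ?case by (simp add: continuous_on_scaleR continuous_on_component)
next
  case (Suc k)
  have "Ck_on k U (\<lambda>x. f x $ j *\<^sub>R partial_deriv i h x + partial_deriv i f x $ j *\<^sub>R h x)" for i
    by (intro Ck_on_add[OF assms] Suc.IH)
       (use Suc.prems[THEN Ck_on_SucD] Suc.prems in \<open>simp_all add: Ck_on_Suc_iff\<close>)
  then have "Ck_on k U (partial_deriv i (\<lambda>x. f x $ j *\<^sub>R h x))" for i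
    by (rule Ck_on_cong[OF assms partial_deriv_component_scaleR[symmetric], rotated 2])
       (use Suc.prems in \<open>auto simp: Ck_on_Suc_iff\<close>)
  then show ?case
    using Suc.prems by (simp add: Ck_on_Suc_iff differentiable_component_scaleR)
qed

lemma Ck_on_compose:
  assumes "open U" "open V"
  shows "Ck_on k U f \<Longrightarrow> Ck_on k V g \<Longrightarrow> g ` V \<subseteq> U \<Longrightarrow> Ck_on k V (\<lambda>x. f (g x))"
proof (induction k arbitrary: f)
  case 0
  then show ?case by (auto intro: continuous_on_compose2)
next
  case (Suc k)
  have diff: "f differentiable (at (g x))" "g differentiable (at x)" if "x \<in> V" for x
    using Suc.prems that by (auto simp: Ck_on_Suc_iff)
  have "Ck_on k V (\<lambda>x. \<Sum>j\<in>UNIV. partial_deriv i g x $ j *\<^sub>R partial_deriv j f (g x))" for i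
    by (intro Ck_on_sum Ck_on_component_scaleR assms finite Suc.IH)
       (use Suc.prems(2)[THEN Ck_on_SucD] Suc.prems in \<open>simp_all add: Ck_on_Suc_iff\<close>)
  then have "Ck_on k V (partial_deriv i (\<lambda>x. f (g x)))" for i
    by (rule Ck_on_cong[OF assms(2) partial_deriv_compose[OF diff, symmetric], rotated 2])
  moreover have "(\<lambda>x. f (g x)) differentiable (at x)" if "x \<in> V" for x
    using differentiable_chain_at[of g x f] diff[OF that] by (simp add: comp_def)
  ultimately show ?case by (simp add: Ck_on_Suc_iff)
qed

lemma Ck_diffeo_onI:
  assumes "open U" "open V" "Ck_on k U f" "Ck_on k V g" "f ` U \<subseteq> V" "g ` V \<subseteq> U"
    and gf: "\<And>x. x \<in> U \<Longrightarrow> g (f x) = x" and fg: "\<And>y. y \<in> V \<Longrightarrow> f (g y) = y"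
  shows "Ck_diffeo_on k U V f"
proof -
  have inj: "inj_on f U" using gf by (rule inj_on_inverseI)
  have "f ` U = V" using assms(5,6) fg by force
  moreover have "Ck_on k V (inv_into U f)"
    by (rule Ck_on_cong[OF assms(2) _ assms(4)])
       (use assms(6) fg inj in \<open>auto intro!: inv_into_f_eq[symmetric]\<close>)
  ultimately show ?thesis using assms inj by (simp add: Ck_diffeo_on_def)
qed

lemma Ck_diffeo_onE:
  assumes "Ck_diffeo_on k U V f"
  obtains g where "open U" "open V" "Ck_on k U f" "Ck_on k V g" "f ` U \<subseteq> V" "g ` V \<subseteq> U"
    "\<forall>x\<in>U. g (f x) = x" "\<forall>y\<in>V. f (g y) = y"
proof (rule that[of "inv_into U f"])
  show "inv_into U f ` V \<subseteq> U" using assms by (auto simp: Ck_diffeo_on_def inv_into_into)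
  show "\<forall>y\<in>V. f (inv_into U f y) = y"
    using assms by (auto simp: Ck_diffeo_on_def f_inv_into_f)
qed (use assms in \<open>auto simp: Ck_diffeo_on_def\<close>)

lemma Ck_diffeo_on_inv_into:
  assumes "Ck_diffeo_on k U V f"
  shows "Ck_diffeo_on k V U (inv_into U f)"
  by (rule Ck_diffeo_onI[where g = f])
     (use assms in \<open>auto simp: Ck_diffeo_on_def inv_into_into f_inv_into_f\<close>)

lemma Ck_diffeo_on_compose:
  assumes "Ck_diffeo_on k U V f" "Ck_diffeo_on k V W g"
  shows "Ck_diffeo_on k U W (g \<circ> f)"
proof -
  obtain f' where f: "open U" "open V" "Ck_on k U f" "Ck_on k V f'" "f ` U \<subseteq> V" "f' ` V \<subseteq> U"
    "\<forall>x\<in>U. f' (f x) = x" "\<forall>y\<in>V. f (f' y) = y"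
    using assms(1) by (elim Ck_diffeo_onE)
  obtain g' where g: "open V" "open W" "Ck_on k V g" "Ck_on k W g'" "g ` V \<subseteq> W" "g' ` W \<subseteq> V"
    "\<forall>x\<in>V. g' (g x) = x" "\<forall>y\<in>W. g (g' y) = y"
    using assms(2) by (elim Ck_diffeo_onE)
  show ?thesis unfolding comp_def
  proof (rule Ck_diffeo_onI[OF f(1) g(2), where g = "\<lambda>x. f' (g' x)"])
    show "Ck_on k U (\<lambda>x. g (f x))" by (rule Ck_on_compose[OF f(2,1) g(3) f(3,5)])
    show "Ck_on k W (\<lambda>x. f' (g' x))" by (rule Ck_on_compose[OF f(2) g(2) f(4) g(4,6)])
    show "f' (g' (g (f x))) = x" if "x \<in> U" for x
      using f(5,7) g(7) that by (simp add: image_subset_iff)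
    show "g (f (f' (g' y))) = y" if "y \<in> W" for y
      using f(8) g(6,8) that by (simp add: image_subset_iff)
  qed (use f(5,6) g(5,6) in \<open>simp_all add: image_subset_iff\<close>)
qed

lemma Ck_diffeo_on_subset:
  assumes "Ck_diffeo_on k U V f" "open U'" "U' \<subseteq> U"
  shows "Ck_diffeo_on k U' (f ` U') f"
proof -
  obtain g where g: "open U" "open V" "Ck_on k U f" "Ck_on k V g" "f ` U \<subseteq> V" "g ` V \<subseteq> U"
    "\<forall>x\<in>U. g (f x) = x" "\<forall>y\<in>V. f (g y) = y"
    using assms(1) by (elim Ck_diffeo_onE)
  have U'V: "f ` U' \<subseteq> V" using g(5) assms(3) by blast
  have "f ` U' = V \<inter> g -` U'"
  proof
    show "f ` U' \<subseteq> V \<inter> g -` U'" using g(7) U'V assms(3) by (auto simp: subset_iff)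
    show "V \<inter> g -` U' \<subseteq> f ` U'" using g(8) by (metis IntE image_eqI subsetI vimageE)
  qed
  then have "open (f ` U')"
    using continuous_open_preimage[OF Ck_on_imp_continuous_on[OF g(4)] g(2) assms(2)] by simp
  then show ?thesis
    by (rule Ck_diffeo_onI[OF assms(2) _ Ck_on_subset[OF g(3) assms(3)] Ck_on_subset[OF g(4) U'V]])
       (use g(7,8) assms(3) in auto)
qed

lemma Ck_submanifold_image:
  fixes S :: "(real^'n::finite) set"
  assumes S: "Ck_submanifold k m S" and \<Phi>: "Ck_diffeo_on k UNIV UNIV \<Phi>"
  shows "Ck_submanifold k m (\<Phi> ` S)"
  unfolding Ck_submanifold_def
proof
  fix p assume "p \<in> \<Phi> ` S"
  then obtain s where s: "s \<in> S" "p = \<Phi> s" by auto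
  obtain U V \<phi> L where chart: "s \<in> U" "Ck_diffeo_on k U V \<phi>" "subspace L" "dim L = m"
      "\<phi> ` (U \<inter> S) = V \<inter> L"
    using S s unfolding Ck_submanifold_def by blast
  have inj: "inj \<Phi>" using \<Phi> by (simp add: Ck_diffeo_on_def)
  have "Ck_diffeo_on k U (\<Phi> ` U) \<Phi>"
    using Ck_diffeo_on_subset[OF \<Phi>, of U] chart(2) by (simp add: Ck_diffeo_on_def)
  then have "Ck_diffeo_on k (\<Phi> ` U) V (\<phi> \<circ> inv_into U \<Phi>)"
    using Ck_diffeo_on_compose[OF Ck_diffeo_on_inv_into chart(2)] by blast
  moreover have "(\<phi> \<circ> inv_into U \<Phi>) ` (\<Phi> ` U \<inter> \<Phi> ` S) = V \<inter> L"
  proof -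
    have "(\<phi> \<circ> inv_into U \<Phi>) ` (\<Phi> ` (U \<inter> S)) = \<phi> ` (U \<inter> S)"
      using inj_on_subset[OF inj] by (simp add: image_image)
    then show ?thesis using chart(5) inj by (simp add: image_Int)
  qed
  ultimately show "\<exists>U V \<phi> L. p \<in> U \<and> Ck_diffeo_on k U V \<phi> \<and> subspace L \<and> dim L = m \<and>
      \<phi> ` (U \<inter> \<Phi> ` S) = V \<inter> L"
    using s chart(1,3,4) by blast
qed

subsection \<open>Bounds on the \<open>C\<^sup>k\<close> norm\<close>

definition Ck_norm_le :: "nat \<Rightarrow> real \<Rightarrow> (real^'n::finite \<Rightarrow> real^'m::finite) \<Rightarrow> bool" where
  "Ck_norm_le k B f \<longleftrightarrow>
     Ck_on k UNIV f \<and> (\<forall>is x. length is \<le> k \<longrightarrow> norm (iter_partial is f x) \<le> B)"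

lemma Ck_norm_le_0_iff: "Ck_norm_le 0 B f \<longleftrightarrow> continuous_on UNIV f \<and> (\<forall>x. norm (f x) \<le> B)"
  by (simp add: Ck_norm_le_def)

lemma Ck_norm_le_Suc_iff:
  "Ck_norm_le (Suc k) B f \<longleftrightarrow> (\<forall>x. f differentiable (at x)) \<and> (\<forall>x. norm (f x) \<le> B) \<and>
     (\<forall>i. Ck_norm_le k B (partial_deriv i f))"
proof -
  have "(\<forall>is x. length is \<le> Suc k \<longrightarrow> norm (iter_partial is f x) \<le> B) \<longleftrightarrow>
      (\<forall>x. norm (f x) \<le> B) \<and>
      (\<forall>i is x. length is \<le> k \<longrightarrow> norm (iter_partial is (partial_deriv i f) x) \<le> B)"
    (is "?all \<longleftrightarrow> ?empty \<and> ?cons")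
  proof
    assume ?all
    then have "norm (iter_partial [] f x) \<le> B" for x by (metis le0 list.size(3))
    moreover have "norm (iter_partial (i # is) f x) \<le> B" if "length is \<le> k" for i "is" x
      using \<open>?all\<close> that by (metis Suc_le_mono length_Cons)
    ultimately show "?empty \<and> ?cons" by simp
  next
    assume bounds: "?empty \<and> ?cons"
    show ?all
    proof (intro allI impI)
      fix "is" :: "'a list" and x assume "length is \<le> Suc k"
      then show "norm (iter_partial is f x) \<le> B" using bounds by (cases "is") auto
    qed
  qed
  then show ?thesis by (auto simp: Ck_norm_le_def Ck_on_Suc_iff)
qed

lemma Ck_norm_le_SucD: "Ck_norm_le (Suc k) B f \<Longrightarrow> Ck_norm_le k B f"
  using Ck_on_SucD by (auto simp: Ck_norm_le_def)

lemma Ck_norm_le_imp_continuous_on: "Ck_norm_le k B f \<Longrightarrow> continuous_on UNIV f"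
  by (auto simp: Ck_norm_le_def intro: Ck_on_imp_continuous_on)

lemma Ck_norm_le_norm: "Ck_norm_le k B f \<Longrightarrow> norm (f x) \<le> B"
  by (cases k) (auto simp: Ck_norm_le_0_iff Ck_norm_le_Suc_iff)

lemma Ck_norm_le_nonneg: "Ck_norm_le k B f \<Longrightarrow> 0 \<le> B"
  using Ck_norm_le_norm order_trans[OF norm_ge_zero] by blast

lemma Ck_norm_le_mono: "Ck_norm_le k A f \<Longrightarrow> A \<le> B \<Longrightarrow> Ck_norm_le k B f"
  unfolding Ck_norm_le_def using order_trans by blast

lemma Ck_norm_le_const: "norm c \<le> B \<Longrightarrow> Ck_norm_le k B (\<lambda>x. c)"
proof (induction k arbitrary: c)
  case 0
  then show ?case by (simp add: Ck_norm_le_0_iff)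
next
  case (Suc k)
  then show ?case using order_trans[OF norm_ge_zero Suc.prems] by (simp add: Ck_norm_le_Suc_iff)
qed

lemma Ck_norm_le_add:
  "Ck_norm_le k A f \<Longrightarrow> Ck_norm_le k B g \<Longrightarrow> Ck_norm_le k (A + B) (\<lambda>x. f x + g x)"
proof (induction k arbitrary: f g)
  case 0
  then show ?case by (auto simp: Ck_norm_le_0_iff intro: continuous_on_add norm_triangle_mono)
next
  case (Suc k)
  have "partial_deriv i (\<lambda>x. f x + g x) = (\<lambda>x. partial_deriv i f x + partial_deriv i g x)" for i
    using Suc.prems by (intro ext partial_deriv_add) (auto simp: Ck_norm_le_Suc_iff)
  then show ?case
    using Suc by (auto simp: Ck_norm_le_Suc_iff intro: norm_triangle_mono)
qed

lemma Ck_norm_le_sum: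
  assumes "finite S" "\<And>t. t \<in> S \<Longrightarrow> Ck_norm_le k (B t) (f t)"
  shows "Ck_norm_le k (\<Sum>t\<in>S. B t) (\<lambda>x. \<Sum>t\<in>S. f t x)"
  using assms by (induction S) (auto intro: Ck_norm_le_const Ck_norm_le_add)

lemma norm_component_scaleR_le:
  fixes y :: "real^'m::finite" and z :: "'a::real_normed_vector"
  assumes "norm y \<le> A" "norm z \<le> B"
  shows "norm (y $ j *\<^sub>R z) \<le> A * B"
proof -
  have "\<bar>y $ j\<bar> \<le> A" by (rule order_trans[OF component_le_norm_cart assms(1)])
  moreover have "0 \<le> A" by (rule order_trans[OF norm_ge_zero assms(1)])
  ultimately show ?thesis using assms(2) by (simp add: mult_mono)
qed

lemma Ck_norm_le_component_scaleR:
  "Ck_norm_le k A f \<Longrightarrow> Ck_norm_le k B h \<Longrightarrow> Ck_norm_le k (2 ^ k * (A * B)) (\<lambda>x. f x $ j *\<^sub>R h x)"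
proof (induction k arbitrary: f h)
  case 0
  then show ?case
    by (simp add: Ck_norm_le_0_iff continuous_on_scaleR continuous_on_component
        norm_component_scaleR_le del: norm_scaleR)
next
  case (Suc k)
  have diff: "f differentiable (at x)" "h differentiable (at x)" for x
    using Suc.prems by (auto simp: Ck_norm_le_Suc_iff)
  have "norm (f x $ j *\<^sub>R h x) \<le> 2 ^ Suc k * (A * B)" for x
  proof -
    have "norm (f x $ j *\<^sub>R h x) \<le> 1 * (A * B)"
      using Suc.prems by (simp add: norm_component_scaleR_le Ck_norm_le_norm del: norm_scaleR)
    also have "\<dots> \<le> 2 ^ Suc k * (A * B)"
      using Suc.prems[THEN Ck_norm_le_nonneg] by (intro mult_right_mono one_le_power) auto
    finally show ?thesis .
  qed
  moreover have "Ck_norm_le k (2 ^ Suc k * (A * B)) (partial_deriv i (\<lambda>x. f x $ j *\<^sub>R h x))" for i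
  proof -
    have "Ck_norm_le k (2 ^ k * (A * B) + 2 ^ k * (A * B))
        (\<lambda>x. f x $ j *\<^sub>R partial_deriv i h x + partial_deriv i f x $ j *\<^sub>R h x)"
      by (intro Ck_norm_le_add Suc.IH)
         (use Suc.prems[THEN Ck_norm_le_SucD] Suc.prems in \<open>simp_all add: Ck_norm_le_Suc_iff\<close>)
    moreover have "partial_deriv i (\<lambda>x. f x $ j *\<^sub>R h x)
        = (\<lambda>x. f x $ j *\<^sub>R partial_deriv i h x + partial_deriv i f x $ j *\<^sub>R h x)"
      using diff by (intro ext partial_deriv_component_scaleR)
    ultimately show ?thesis by (simp add: mult_ac)
  qed
  moreover have "(\<lambda>x. f x $ j *\<^sub>R h x) differentiable (at x)" for x
    using diff by (rule differentiable_component_scaleR)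
  ultimately show ?case by (simp add: Ck_norm_le_Suc_iff)
qed

lemma Ck_norm_le_scaleR:
  assumes "Ck_norm_le k B f"
  shows "Ck_norm_le k (\<bar>a\<bar> * B) (\<lambda>x. a *\<^sub>R f x)"
  using assms
proof (induction k arbitrary: f)
  case 0
  then show ?case by (simp add: Ck_norm_le_0_iff continuous_on_scaleR mult_left_mono)
next
  case (Suc k)
  have "partial_deriv i (\<lambda>x. a *\<^sub>R f x) = (\<lambda>x. a *\<^sub>R partial_deriv i f x)" for i
    unfolding partial_deriv_def[of i f]
    using Suc.prems frechet_derivative_works
    by (intro ext partial_deriv_eqI has_derivative_scaleR_right) (auto simp: Ck_norm_le_Suc_iff)
  then show ?case using Suc by (simp add: Ck_norm_le_Suc_iff mult_left_mono)
qed

lemma rescale_has_derivative: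
  assumes "f differentiable (at ((x - q) /\<^sub>R r))"
  shows "((\<lambda>x. f ((x - q) /\<^sub>R r)) has_derivative
    (\<lambda>y. frechet_derivative f (at ((x - q) /\<^sub>R r)) y /\<^sub>R r)) (at x)"
proof -
  have "((\<lambda>x. (x - q) /\<^sub>R r) has_derivative (\<lambda>y. y /\<^sub>R r)) (at x)"
    by (auto intro!: derivative_eq_intros)
  from has_derivative_compose[OF this assms[unfolded frechet_derivative_works]]
  show ?thesis by (simp add: linear_scale[OF linear_frechet_derivative[OF assms]])
qed

lemma Ck_norm_le_rescale:
  assumes r: "0 < r" "r \<le> 1" and f: "Ck_norm_le k B f"
  shows "Ck_norm_le k (B / r ^ k) (\<lambda>x. f ((x - q) /\<^sub>R r))"
  using f
proof (induction k arbitrary: f)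
  case 0
  have "continuous_on UNIV (\<lambda>x. (x - q) /\<^sub>R r)" by (intro continuous_intros)
  then show ?case using 0 by (auto simp: Ck_norm_le_0_iff intro: continuous_on_compose2)
next
  case (Suc k)
  have deriv: "((\<lambda>x. f ((x - q) /\<^sub>R r)) has_derivative
      (\<lambda>y. frechet_derivative f (at ((x - q) /\<^sub>R r)) y /\<^sub>R r)) (at x)" for x
    using Suc.prems by (intro rescale_has_derivative) (simp add: Ck_norm_le_Suc_iff)
  have "partial_deriv i (\<lambda>x. f ((x - q) /\<^sub>R r))
      = (\<lambda>x. (1 / r) *\<^sub>R partial_deriv i f ((x - q) /\<^sub>R r))" for i
    using partial_deriv_eqI[OF deriv]
    by (simp add: partial_deriv_def[of i f] fun_eq_iff divide_inverse)
  moreover have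
    "Ck_norm_le k (\<bar>1 / r\<bar> * (B / r ^ k)) (\<lambda>x. (1 / r) *\<^sub>R partial_deriv i f ((x - q) /\<^sub>R r))" for i
    using Suc.prems by (intro Ck_norm_le_scaleR Suc.IH) (simp add: Ck_norm_le_Suc_iff)
  moreover have "norm (f x) \<le> B / r ^ Suc k" for x
  proof -
    have "B / 1 \<le> B / r ^ Suc k"
      using r Ck_norm_le_nonneg[OF Suc.prems] by (intro divide_left_mono power_le_one) auto
    then show ?thesis using Ck_norm_le_norm[OF Suc.prems, of x] by simp
  qed
  moreover have "(\<lambda>x. f ((x - q) /\<^sub>R r)) differentiable (at x)" for x
    using deriv by (rule differentiableI)
  ultimately show ?case
    using r by (simp add: Ck_norm_le_Suc_iff)
qed

lemma Ck_norm_le_one_variable_Suc: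
  fixes g g' :: "real \<Rightarrow> real" and v :: "real^'m::finite" and l :: "'n::finite"
  assumes deriv: "\<And>t. (g has_real_derivative g' t) (at t)" and bound: "\<And>t. \<bar>g t\<bar> \<le> B"
    and g': "Ck_norm_le k (B * norm v) (\<lambda>x::real^'n. g' (x $ l) *\<^sub>R v)"
  shows "Ck_norm_le (Suc k) (B * norm v) (\<lambda>x::real^'n. g (x $ l) *\<^sub>R v)"
proof -
  have has_deriv:
    "((\<lambda>x::real^'n. g (x $ l) *\<^sub>R v) has_derivative (\<lambda>y. (y $ l * g' (x $ l)) *\<^sub>R v)) (at x)"
    for x
    using has_derivative_scaleR_left[OF has_derivative_compose[OF
          bounded_linear.has_derivative[OF bounded_linear_vec_nth has_derivative_ident]
          deriv[unfolded has_field_derivative_def]]]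
    by (simp add: mult.commute)
  have "partial_deriv i (\<lambda>x. g (x $ l) *\<^sub>R v) = (if i = l then (\<lambda>x. g' (x $ l) *\<^sub>R v) else (\<lambda>x. 0))"
    for i
    by (rule ext, subst partial_deriv_eqI[OF has_deriv]) (auto simp: axis_def)
  then have "Ck_norm_le k (B * norm v) (partial_deriv i (\<lambda>x. g (x $ l) *\<^sub>R v))" for i
    using g' Ck_norm_le_nonneg[OF g'] by (simp add: Ck_norm_le_const)
  then show ?thesis
    using has_deriv[THEN differentiableI] bound by (simp add: Ck_norm_le_Suc_iff mult_right_mono)
qed

lemma iter_partial_cong:
  assumes "open U" "x \<in> U" "\<And>y. y \<in> U \<Longrightarrow> f y = g y"
  shows "iter_partial is f x = iter_partial is g x"
  using assms(3)
proof (induction "is" arbitrary: f g)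
  case Nil
  then show ?case using assms(2) by simp
next
  case (Cons i "is")
  have "partial_deriv i f y = partial_deriv i g y" if "y \<in> U" for y
    by (rule partial_deriv_cong[OF assms(1) that Cons.prems])
  then show ?case by (simp add: Cons.IH[of "partial_deriv i f" "partial_deriv i g"])
qed

lemma Ck_norm_le_sum_disjoint_supports:
  fixes f :: "'z \<Rightarrow> real^'n::finite \<Rightarrow> real^'m::finite"
  assumes Z: "finite Z" and B: "0 \<le> B" and f: "\<And>z. z \<in> Z \<Longrightarrow> Ck_norm_le k B (f z)"
    and A: "\<And>z. z \<in> Z \<Longrightarrow> closed (A z)" "disjoint_family_on A Z"
    and supp: "\<And>z x. z \<in> Z \<Longrightarrow> x \<notin> A z \<Longrightarrow> f z x = 0"
  shows "Ck_norm_le k B (\<lambda>x. \<Sum>z\<in>Z. f z x)"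
  unfolding Ck_norm_le_def
proof (intro conjI allI impI)
  show "Ck_on k UNIV (\<lambda>x. \<Sum>z\<in>Z. f z x)"
    using f by (intro Ck_on_sum Z) (auto simp: Ck_norm_le_def)
  fix "is" :: "'n list" and x assume len: "length is \<le> k"
  define Y where "Y = {z \<in> Z. x \<in> A z}"
  have "Ck_norm_le k B (\<lambda>x. \<Sum>z\<in>Y. f z x)"
  proof (cases "Y = {}")
    case False
    then obtain z where "Y = {z}" "z \<in> Z"
      using A(2) unfolding Y_def disjoint_family_on_def by blast
    then show ?thesis using f by simp
  qed (use B in \<open>simp add: Ck_norm_le_const\<close>)
  moreover have "iter_partial is (\<lambda>x. \<Sum>z\<in>Z. f z x) x = iter_partial is (\<lambda>x. \<Sum>z\<in>Y. f z x) x"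
  proof (rule iter_partial_cong)
    show "open (- (\<Union>z\<in>Z - Y. A z))" using Z A(1) by (intro open_Compl closed_UN) auto
    show "x \<in> - (\<Union>z\<in>Z - Y. A z)" by (auto simp: Y_def)
    show "(\<Sum>z\<in>Z. f z y) = (\<Sum>z\<in>Y. f z y)" if "y \<in> - (\<Union>z\<in>Z - Y. A z)" for y
      using that Z supp by (intro sum.mono_neutral_right) (auto simp: Y_def)
  qed
  ultimately show "norm (iter_partial is (\<lambda>x. \<Sum>z\<in>Z. f z x) x) \<le> B"
    using len by (simp add: Ck_norm_le_def)
qed

lemma Ck_norm_le_sin:
  "Ck_norm_le k (norm v) (\<lambda>x::real^'n::finite. sin (x $ l - a) *\<^sub>R (v :: real^'m::finite))"
proof (induction k arbitrary: a)
  case 0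
  have "continuous_on UNIV (\<lambda>x::real^'n. sin (x $ l - a) *\<^sub>R v)" by (intro continuous_intros)
  then show ?case by (simp add: Ck_norm_le_0_iff mult_left_le_one_le)
next
  case (Suc k)
  have "sin (t - (a - pi / 2)) = cos (t - a)" for t
    using sin_add[of "t - a" "pi / 2"] by (simp add: algebra_simps)
  then have "((\<lambda>t. sin (t - a)) has_real_derivative sin (t - (a - pi / 2))) (at t)" for t
    by (auto intro!: derivative_eq_intros)
  from Ck_norm_le_one_variable_Suc[OF this, of 1 k v l] show ?case using Suc.IH by simp
qed

subsection \<open>A \<open>C\<^sup>k\<close> bump function\<close>

definition truncated_poly :: "real poly \<Rightarrow> real \<Rightarrow> real" where
  "truncated_poly p t = (if \<bar>t\<bar> < 1 then poly p t else 0)"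

lemma power_dvd_pderiv:
  fixes p q :: "'a::idom poly"
  assumes "q ^ Suc j dvd p"
  shows "q ^ j dvd pderiv p"
proof -
  obtain r where "p = q ^ Suc j * r" using assms by (elim dvdE)
  then have "pderiv p = q ^ j * (q * pderiv r + smult (of_nat (Suc j)) (pderiv q * r))"
    by (simp only: pderiv_mult pderiv_power_Suc) (simp add: algebra_simps)
  then show ?thesis by simp
qed

lemma truncated_poly_has_real_derivative:
  assumes "[:1, 0, -1:] ^ 2 dvd p"
  shows "(truncated_poly p has_real_derivative truncated_poly (pderiv p) t) (at t)"
proof -
  have "[:1, 0, -1:] dvd p" by (rule dvd_trans[OF dvd_power assms]) simp
  moreover have "[:1, 0, -1:] dvd pderiv p"
    using power_dvd_pderiv[of "[:1, 0, -1:]" 1 p] assms by (simp only: Suc_1 power_one_right)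
  ultimately have roots:
    "poly p 1 = 0" "poly p (-1) = 0" "poly (pderiv p) 1 = 0" "poly (pderiv p) (-1) = 0"
    by (auto elim!: dvdE)
  have closure: "closure (- {-1..1::real}) = {..-1} \<union> {1..}"
  proof -
    have "- {-1..1::real} = {..<-1} \<union> {1<..}" by auto
    then show ?thesis by (simp add: closure_Un)
  qed
  have "((\<lambda>t. if t \<in> {-1..1} then poly p t else 0) has_derivative
      (if t \<in> {-1..1} then (*) (poly (pderiv p) t) else (\<lambda>_. 0)))
          (at t within {-1..1} \<union> (- {-1..1}))"
    by (rule has_derivative_If_within_closures)
       (use roots poly_DERIV[of p t] in
         \<open>auto simp: closure has_field_derivative_def intro: has_derivative_at_withinI\<close>)
  moreover have "truncated_poly p = (\<lambda>t. if t \<in> {-1..1} then poly p t else 0)"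
    using roots(1,2) by (auto simp: truncated_poly_def fun_eq_iff abs_if)
  ultimately show ?thesis
    unfolding has_field_derivative_def using roots(3,4)
    by (auto simp: truncated_poly_def abs_if split: if_splits elim!: has_derivative_eq_rhs)
qed

lemma truncated_poly_bounded:
  obtains M where "\<And>t. \<bar>truncated_poly p t\<bar> \<le> M"
proof -
  have "compact (poly p ` {-1..1})"
    by (intro compact_continuous_image continuous_intros) auto
  then obtain M where "\<forall>y\<in>poly p ` {-1..1}. norm y \<le> M"
    using compact_imp_bounded bounded_iff by metis
  then have "\<bar>truncated_poly p t\<bar> \<le> max M 0" for t
    by (auto simp: truncated_poly_def abs_less_iff intro: max.coboundedI1)
  then show ?thesis by (rule that)
qed

lemma Ck_norm_le_truncated_poly:
  "[:1, 0, -1:] ^ (k + 2) dvd p \<Longrightarrow> \<exists>M. \<forall>l v. Ck_norm_le k (M * norm v)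
     (\<lambda>x::real^'n::finite. truncated_poly p (x $ l) *\<^sub>R (v :: real^'m::finite))"
proof (induction k arbitrary: p)
  case 0
  obtain M where M: "\<And>t. \<bar>truncated_poly p t\<bar> \<le> M" using truncated_poly_bounded by blast
  have "continuous_on UNIV (truncated_poly p)"
    using truncated_poly_has_real_derivative 0
    by (metis DERIV_isCont add_0 continuous_at_imp_continuous_on)
  then have "continuous_on UNIV (\<lambda>x::real^'n. truncated_poly p (x $ l) *\<^sub>R v)"
    for l and v :: "real^'m"
    by (intro continuous_on_scaleR continuous_on_const
        continuous_on_compose2[of UNIV "truncated_poly p" UNIV "\<lambda>x. x $ l"] continuous_on_component
        continuous_on_id) auto
  then show ?case using M by (auto simp: Ck_norm_le_0_iff intro!: exI[of _ M] mult_right_mono)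
next
  case (Suc k)
  obtain M where M: "\<And>t. \<bar>truncated_poly p t\<bar> \<le> M" using truncated_poly_bounded by blast
  have "[:1, 0, -1:] ^ (k + 2) dvd pderiv p"
    using power_dvd_pderiv[of _ "k + 2"] Suc.prems by (simp only: add_Suc)
  then obtain M' where M':
    "Ck_norm_le k (M' * norm v) (\<lambda>x::real^'n. truncated_poly (pderiv p) (x $ l) *\<^sub>R v)"
    for l and v :: "real^'m" using Suc.IH by blast
  have "[:1, 0, -1:] ^ 2 dvd p"
    by (rule dvd_trans[OF le_imp_power_dvd Suc.prems]) simp
  note deriv = truncated_poly_has_real_derivative[OF this]
  have "Ck_norm_le (Suc k) (max M M' * norm v) (\<lambda>x::real^'n. truncated_poly p (x $ l) *\<^sub>R v)"
    for l and v :: "real^'m"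
    by (rule Ck_norm_le_one_variable_Suc[OF deriv max.coboundedI1[OF M] Ck_norm_le_mono[OF M']])
       (simp add: mult_right_mono)
  then show ?case by blast
qed

lemma Ck_norm_le_prod_scaleR:
  fixes g :: "'i \<Rightarrow> real^'n::finite \<Rightarrow> real"
  assumes "finite I"
    and g: "\<And>l v. l \<in> I \<Longrightarrow> Ck_norm_le k (A * norm v) (\<lambda>x. g l x *\<^sub>R (v :: real^'m::finite))"
  shows "Ck_norm_le k ((2 ^ k * A) ^ card I * norm v) (\<lambda>x. (\<Prod>l\<in>I. g l x) *\<^sub>R (v :: real^'m))"
  using assms
proof (induction I)
  case empty
  then show ?case by (simp add: Ck_norm_le_const)
next
  case (insert l I)
  obtain j :: 'm where "j \<in> UNIV" by blast
  have "Ck_norm_le k A (\<lambda>x. g l x *\<^sub>R (axis j 1 :: real^'m))"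
    using insert.prems[of l "axis j 1"] by simp
  then have "Ck_norm_le k (2 ^ k * (A * ((2 ^ k * A) ^ card I * norm v)))
      (\<lambda>x. (g l x *\<^sub>R (axis j 1 :: real^'m)) $ j *\<^sub>R ((\<Prod>l\<in>I. g l x) *\<^sub>R v))"
    by (rule Ck_norm_le_component_scaleR) (use insert in auto)
  then show ?case using insert.hyps by (simp add: mult_ac)
qed

lemma Ck_norm_le_scaleR_bound_nonneg:
  assumes "\<And>v. Ck_norm_le k (M * norm v) (\<lambda>x::real^'n::finite. g x *\<^sub>R (v :: real^'m::finite))"
  shows "0 \<le> M"
proof -
  obtain i :: 'm where "i \<in> UNIV" by blast
  show ?thesis using Ck_norm_le_nonneg[OF assms[of "axis i 1"]] by simp
qed

definition cube_bump :: "nat \<Rightarrow> 'n::finite set \<Rightarrow> real^'n \<Rightarrow> real" where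
  "cube_bump k I x = (\<Prod>l\<in>I. truncated_poly ([:1, 0, -1:] ^ (k + 2)) (x $ l))"

lemma cube_bump_cong: "(\<And>l. l \<in> I \<Longrightarrow> x $ l = y $ l) \<Longrightarrow> cube_bump k I x = cube_bump k I y"
  by (simp add: cube_bump_def)

lemma cube_bump_0 [simp]: "cube_bump k I 0 = 1"
  by (simp add: cube_bump_def truncated_poly_def)

lemma cube_bump_eq_0: "l \<in> I \<Longrightarrow> 1 \<le> \<bar>x $ l\<bar> \<Longrightarrow> cube_bump k I x = 0"
  unfolding cube_bump_def
  by (intro prod_zero bexI[of _ l]) (simp_all add: truncated_poly_def)

lemma Ck_norm_le_cube_bump:
  obtains M where
    "\<forall>v. Ck_norm_le k (M * norm v)
        (\<lambda>x::real^'n::finite. cube_bump k I x *\<^sub>R (v :: real^'m::finite))"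
proof -
  obtain A where "Ck_norm_le k (A * norm v)
      (\<lambda>x::real^'n. truncated_poly ([:1, 0, -1:] ^ (k + 2)) (x $ l) *\<^sub>R v)" for l and v :: "real^'m"
    using Ck_norm_le_truncated_poly[OF dvd_refl] by blast
  then have "Ck_norm_le k ((2 ^ k * A) ^ card I * norm v) (\<lambda>x. cube_bump k I x *\<^sub>R v)"
    for v :: "real^'m"
    unfolding cube_bump_def by (intro Ck_norm_le_prod_scaleR) auto
  then show ?thesis using that by blast
qed

subsection \<open>Coordinate projections of submanifolds\<close>

lemma axis_expansion_on:
  fixes x :: "real^'n::finite"
  assumes "\<And>l. l \<notin> J \<Longrightarrow> x $ l = 0"
  shows "x = (\<Sum>j\<in>J. x $ j *\<^sub>R axis j 1)"
proof -
  have "x = (\<Sum>j\<in>UNIV. x $ j *\<^sub>R axis j 1)"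
    by (rule linear_axis_expansion[OF linear_ident])
  also have "\<dots> = (\<Sum>j\<in>J. x $ j *\<^sub>R axis j 1)"
    using assms by (intro sum.mono_neutral_right) auto
  finally show ?thesis .
qed

lemma basis_extend_by_axes:
  fixes W :: "(real^'n::finite) set"
  assumes "subspace W"
  obtains B J where "B \<subseteq> W" "W \<subseteq> span B" "independent (B \<union> (\<lambda>j. axis j 1) ` J)"
    "span (B \<union> (\<lambda>j. axis j 1) ` J) = UNIV" "B \<inter> (\<lambda>j. axis j 1) ` J = {}"
    "card J = CARD('n) - dim W"
proof -
  obtain B where B: "B \<subseteq> W" "independent B" "W \<subseteq> span B" "card B = dim W"
    using basis_exists by blast
  obtain S where S: "B \<subseteq> S" "S \<subseteq> B \<union> Basis" "independent S" "B \<union> Basis \<subseteq> span S"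
    using maximal_independent_subset_extend[of B "B \<union> Basis"] B by blast
  have span_S: "span S = UNIV"
    using S(4) by (metis Un_subset_iff span_Basis span_mono span_span top.extremum_uniqueI)
  define J where "J = {j. axis j (1::real) \<in> S - B}"
  have diff: "S - B = (\<lambda>j. axis j 1) ` J"
    using S(2) by (auto simp: J_def Basis_vec_def)
  have "card S = CARD('n)"
    using dim_eq_card_independent[OF S(3)] span_S
    by (metis dim_span dim_UNIV DIM_cart DIM_real mult.right_neutral)
  moreover have "inj_on (\<lambda>j. axis j (1::real)) J" by (auto simp: inj_on_def axis_eq_axis)
  ultimately have "card J = CARD('n) - dim W"
    using independent_imp_finite[OF B(2)] S(1) B(4)
    by (simp flip: card_image diff add: card_Diff_subset)
  moreover have "B \<union> (\<lambda>j. axis j 1) ` J = S" using S(1) by (auto simp flip: diff)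
  ultimately show ?thesis
    using that[of B J] B S(3) span_S by (auto simp flip: diff)
qed

lemma axis_projection_along_subspace:
  fixes W :: "(real^'n::finite) set"
  assumes "subspace W"
  obtains J and Q :: "real^'n \<Rightarrow> real^'n" where "card J = CARD('n) - dim W" "linear Q"
    "\<forall>w\<in>W. Q w = 0" "\<forall>j\<in>J. Q (axis j 1) = axis j 1" "span (W \<union> (\<lambda>j. axis j 1) ` J) = UNIV"
proof -
  obtain B J where B: "B \<subseteq> W" "W \<subseteq> span B" and ind: "independent (B \<union> (\<lambda>j. axis j 1) ` J)"
    and spanning: "span (B \<union> (\<lambda>j. axis j 1) ` J) = UNIV"
    and disjoint: "B \<inter> (\<lambda>j. axis j 1) ` J = {}" and card_J: "card J = CARD('n) - dim W"
    by (rule basis_extend_by_axes[OF assms])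
  obtain Q :: "real^'n \<Rightarrow> real^'n" where Q: "linear Q"
    and "\<forall>x\<in>B \<union> (\<lambda>j. axis j 1) ` J. Q x = (if x \<in> B then 0 else x)"
    using linear_independent_extend[OF ind, of "\<lambda>x. if x \<in> B then 0 else x"] by blast
  then have Q_B: "\<And>b. b \<in> B \<Longrightarrow> Q b = 0" and "\<forall>j\<in>J. Q (axis j 1) = axis j 1"
    using disjoint by auto
  moreover have "\<forall>w\<in>W. Q w = 0"
    using linear_eq_0_on_span[OF Q Q_B] B(2) by blast
  moreover have "span (W \<union> (\<lambda>j. axis j 1) ` J) = UNIV"
    using span_mono[of "B \<union> (\<lambda>j. axis j 1) ` J" "W \<union> (\<lambda>j. axis j 1) ` J"] B(1) spanning by blast
  ultimately show ?thesis using that Q card_J by blast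
qed

lemma coordinate_projection_along_subspace:
  fixes W :: "(real^'n::finite) set"
  assumes W: "subspace W"
  obtains I :: "'n set" and Q :: "real^'n \<Rightarrow> real^'n" where "card I = dim W" "linear Q"
    "\<forall>x. \<forall>l\<in>I. Q x $ l = 0" "\<forall>x. (\<forall>l\<in>I. x $ l = 0) \<longrightarrow> Q x = x"
    "\<forall>x. Q x = 0 \<longleftrightarrow> x \<in> W"
proof -
  obtain J and Q :: "real^'n \<Rightarrow> real^'n" where card_J: "card J = CARD('n) - dim W"
    and Q: "linear Q" "\<forall>w\<in>W. Q w = 0" "\<forall>j\<in>J. Q (axis j 1) = axis j 1"
    and spanning: "span (W \<union> (\<lambda>j. axis j 1) ` J) = UNIV"
    by (rule axis_projection_along_subspace[OF W])
  have x_span: "x \<in> span (W \<union> (\<lambda>j. axis j 1) ` J)" for x using spanning by simp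
  have "Q x $ l = 0" if l: "l \<in> - J" for x l
    using x_span[of x]
  proof (rule span_induct)
    show "subspace {x. Q x $ l = 0}"
      by (simp add: subspace_def linear_0[OF Q(1)] linear_add[OF Q(1)] linear_scale[OF Q(1)])
    show "Q b $ l = 0" if "b \<in> W \<union> (\<lambda>j. axis j 1) ` J" for b
      using that l Q(2,3) by (auto simp: axis_def)
  qed
  moreover have "Q x = x" if "\<forall>l\<in>- J. x $ l = 0" for x
  proof -
    have x: "x = (\<Sum>j\<in>J. x $ j *\<^sub>R axis j 1)" using that by (intro axis_expansion_on) auto
    show ?thesis
      by (subst (1 2) x) (simp add: linear_sum[OF Q(1)] linear_scale[OF Q(1)] Q(3))
  qed
  moreover have "Q x = 0 \<longleftrightarrow> x \<in> W" for x
  proof -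
    have "x - Q x \<in> W"
      using x_span[of x]
    proof (rule span_induct)
      show "subspace {x. x - Q x \<in> W}"
        using linear_subspace_linear_preimage[OF linear_compose_sub[OF linear_id Q(1)] W] by simp
      show "b - Q b \<in> W" if "b \<in> W \<union> (\<lambda>j. axis j 1) ` J" for b
        using that Q(2,3) subspace_0[OF W] by auto
    qed
    then show ?thesis using Q(2) by auto
  qed
  moreover have "card (- J) = dim W"
    using card_J dim_subset_UNIV[of W] by (simp add: Compl_eq_Diff_UNIV card_Diff_subset)
  ultimately show ?thesis using that[of "- J" Q] Q(1) by blast
qed

lemma Ck_submanifold_straightening:
  fixes S :: "(real^'n::finite) set"
  assumes S: "Ck_submanifold k m S" and k: "k \<ge> 1" and p: "p \<in> S"
  obtains U W and h :: "real^'n \<Rightarrow> real^'n" where "open U" "p \<in> U" "subspace W" "dim W = m"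
    "continuous_on U h" "(h has_derivative (\<lambda>y. y)) (at p)" "\<forall>x\<in>U. h x \<in> W \<longleftrightarrow> x \<in> S"
proof -
  obtain U V \<phi> L where chart: "p \<in> U" "Ck_diffeo_on k U V \<phi>" "subspace L" "dim L = m"
      "\<phi> ` (U \<inter> S) = V \<inter> L"
    using S p unfolding Ck_submanifold_def by blast
  obtain \<psi> where U: "open U" "open V" and Ck: "Ck_on k U \<phi>" "Ck_on k V \<psi>"
    and im: "\<phi> ` U \<subseteq> V" "\<psi> ` V \<subseteq> U" and inv: "\<forall>x\<in>U. \<psi> (\<phi> x) = x" "\<forall>y\<in>V. \<phi> (\<psi> y) = y"
    using chart(2) by (elim Ck_diffeo_onE)
  obtain \<phi>' where \<phi>': "(\<phi> has_derivative \<phi>') (at p)"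
    using Ck_on_imp_differentiable[OF Ck(1) k chart(1)] by (auto simp: differentiable_def)
  have "\<phi> p \<in> V" using im(1) chart(1) by auto
  then obtain \<psi>' where \<psi>': "(\<psi> has_derivative \<psi>') (at (\<phi> p))"
    using Ck_on_imp_differentiable[OF Ck(2) k] by (auto simp: differentiable_def)
  have lin: "linear \<psi>'" using \<psi>' by (rule has_derivative_linear)
  have "((\<lambda>x. x) has_derivative (\<lambda>y. \<psi>' (\<phi>' y))) (at p)"
    by (rule has_derivative_transform_within_open[OF
          has_derivative_compose[OF \<phi>' \<psi>'] U(1) chart(1)])
       (use inv(1) in auto)
  then have id: "(\<lambda>y. \<psi>' (\<phi>' y)) = (\<lambda>y. y)"
    by (rule has_derivative_unique[OF _ has_derivative_ident])
  have inj: "inj \<psi>'"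
    using linear_surjective_imp_injective[OF lin] id by (metis surjI)
  show ?thesis
  proof (rule that[of U "\<psi>' ` L" "\<lambda>x. \<psi>' (\<phi> x)"])
    show "subspace (\<psi>' ` L)" using lin chart(3) by (rule linear_subspace_image)
    show "dim (\<psi>' ` L) = m"
      using dim_image_eq[OF lin] inj chart(4) by (metis inj_on_subset subset_UNIV)
    show "continuous_on U (\<lambda>x. \<psi>' (\<phi> x))"
      using linear_continuous_on_compose[OF Ck_on_imp_continuous_on[OF Ck(1)] lin] .
    show "((\<lambda>x. \<psi>' (\<phi> x)) has_derivative (\<lambda>y. y)) (at p)"
      using has_derivative_compose[OF \<phi>' linear_imp_has_derivative[OF lin]] by (simp add: id)
    show "\<forall>x\<in>U. \<psi>' (\<phi> x) \<in> \<psi>' ` L \<longleftrightarrow> x \<in> S"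
    proof
      fix x assume x: "x \<in> U"
      have "\<psi>' (\<phi> x) \<in> \<psi>' ` L \<longleftrightarrow> \<phi> x \<in> V \<inter> L" using inj im(1) x by (auto simp: inj_image_mem_iff)
      also have "\<dots> \<longleftrightarrow> x \<in> S"
        unfolding chart(5)[symmetric] using inv(1) x by (metis Int_iff image_iff)
      finally show "\<psi>' (\<phi> x) \<in> \<psi>' ` L \<longleftrightarrow> x \<in> S" .
    qed
  qed fact+
qed

lemma norm_le_CARD_mult:
  fixes x :: "real^'n::finite"
  assumes "\<And>j. \<bar>x $ j\<bar> \<le> B"
  shows "norm x \<le> real CARD('n) * B"
  using norm_le_l1_cart[of x] sum_mono[of UNIV "\<lambda>j. \<bar>x $ j\<bar>" "\<lambda>_. B"] assms by simp

lemma injective_derivative_imp_mem_interior_image: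
  fixes f :: "'a::euclidean_space \<Rightarrow> 'a"
  assumes U: "open U" "p \<in> U" and f: "continuous_on U f" "(f has_derivative f') (at p)"
    and inj: "inj f'"
  shows "f p \<in> interior (f ` U)"
proof -
  have lin: "linear f'" using f(2) by (rule has_derivative_linear)
  obtain g' where g': "linear g'" "\<forall>x. f' (g' x) = x"
    using linear_injective_isomorphism[OF lin inj] by blast
  show ?thesis
    by (rule sussmann_open_mapping[OF U(1) f(1) U(2) f(2)
          g'(1)[unfolded linear_conv_bounded_linear]])
       (use U g'(2) in \<open>simp_all add: interior_open fun_eq_iff\<close>)
qed

definition coordinate_restriction :: "'n::finite set \<Rightarrow> real^'n \<Rightarrow> real^'n" where
  "coordinate_restriction I x = (\<chi> l. if l \<in> I then x $ l else 0)"

lemma linear_coordinate_restriction: "linear (coordinate_restriction I)"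
  by (rule linearI) (auto simp: coordinate_restriction_def vec_eq_iff)

lemma inj_coordinate_restriction_add:
  assumes "linear Q" "\<forall>x. \<forall>l\<in>I. Q x $ l = 0" "\<forall>x. (\<forall>l\<in>I. x $ l = 0) \<longrightarrow> Q x = x"
  shows "inj (\<lambda>x. coordinate_restriction I x + Q x)"
proof -
  have lin: "linear (\<lambda>x. coordinate_restriction I x + Q x)"
    by (intro linear_compose_add linear_coordinate_restriction assms(1))
  show ?thesis
    unfolding linear_injective_0[OF lin]
  proof (intro allI impI)
    fix x assume zero: "coordinate_restriction I x + Q x = 0"
    have x_I: "x $ l = 0" if "l \<in> I" for l
      using arg_cong[OF zero, of "\<lambda>y. y $ l"] that assms(2)
      by (simp add: coordinate_restriction_def)
    then have "coordinate_restriction I x = 0" by (simp add: coordinate_restriction_def vec_eq_iff)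
    moreover have "Q x = x" using x_I assms(3) by blast
    ultimately show "x = 0" using zero by simp
  qed
qed

lemma coordinate_restriction_add_mem_interior:
  assumes U: "open U" "p \<in> U" and h: "continuous_on U h" "(h has_derivative (\<lambda>y. y)) (at p)"
    and Q: "linear Q" "\<forall>x. \<forall>l\<in>I. Q x $ l = 0" "\<forall>x. (\<forall>l\<in>I. x $ l = 0) \<longrightarrow> Q x = x"
  shows "coordinate_restriction I p + Q (h p)
    \<in> interior ((\<lambda>x. coordinate_restriction I x + Q (h x)) ` U)"
proof (rule injective_derivative_imp_mem_interior_image[OF U])
  show "continuous_on U (\<lambda>x. coordinate_restriction I x + Q (h x))"
    by (intro continuous_on_add linear_continuous_on_compose[OF h(1) Q(1)]
        linear_continuous_on linear_coordinate_restriction[unfolded linear_conv_bounded_linear])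
  show "((\<lambda>x. coordinate_restriction I x + Q (h x)) has_derivative
      (\<lambda>x. coordinate_restriction I x + Q x)) (at p)"
    by (intro has_derivative_add linear_imp_has_derivative[OF linear_coordinate_restriction]
        has_derivative_compose[OF h(2) linear_imp_has_derivative[OF Q(1)]])
  show "inj (\<lambda>x. coordinate_restriction I x + Q x)"
    by (rule inj_coordinate_restriction_add[OF Q])
qed

definition projects_onto_cube :: "'n::finite set \<Rightarrow> real^'n \<Rightarrow> real \<Rightarrow> (real^'n) set \<Rightarrow> bool" where
  "projects_onto_cube I c \<rho> S \<longleftrightarrow>
     (\<forall>x. (\<forall>l\<in>I. \<bar>x $ l - c $ l\<bar> \<le> \<rho>) \<longrightarrow> (\<exists>p\<in>S. \<forall>l\<in>I. p $ l = x $ l))"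

lemma projects_onto_cubeI:
  fixes c :: "real^'n::finite"
  assumes "e > 0"
    and hit: "\<And>y. y \<in> ball (coordinate_restriction I c) e \<Longrightarrow> \<forall>l. l \<notin> I \<longrightarrow> y $ l = 0 \<Longrightarrow>
      \<exists>p\<in>S. \<forall>l\<in>I. p $ l = y $ l"
  obtains \<rho> where "0 < \<rho>" "\<rho> \<le> 1" "projects_onto_cube I c \<rho> S"
proof -
  define \<rho> where "\<rho> = min 1 (e / (2 * real CARD('n)))"
  have \<rho>: "0 < \<rho>" "\<rho> \<le> 1" using assms(1) by (auto simp: \<rho>_def)
  have "\<exists>p\<in>S. \<forall>l\<in>I. p $ l = x $ l" if x: "\<forall>l\<in>I. \<bar>x $ l - c $ l\<bar> \<le> \<rho>" for x
  proof -
    have "norm (coordinate_restriction I x - coordinate_restriction I c) \<le> real CARD('n) * \<rho>"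
      using x \<rho> by (intro norm_le_CARD_mult) (auto simp: coordinate_restriction_def)
    also have "\<dots> \<le> real CARD('n) * (e / (2 * real CARD('n)))"
      by (intro mult_left_mono) (simp_all add: \<rho>_def)
    also have "\<dots> < e" using assms(1) by simp
    finally have "coordinate_restriction I x \<in> ball (coordinate_restriction I c) e"
      by (simp add: dist_norm norm_minus_commute)
    from hit[OF this] show ?thesis by (simp add: coordinate_restriction_def)
  qed
  then show ?thesis using that \<rho> by (simp add: projects_onto_cube_def)
qed

text \<open>Near a point, \<open>S\<close> is \<open>{x. Q (h x) = 0}\<close> with \<open>Q\<close> the projection onto \<open>{x. x\<^sub>I = 0}\<close> along the
tangent space. The map \<open>x \<mapsto> x\<^sub>I + Q (h x)\<close> has invertible derivative, so its values include every
\<open>y\<close> near \<open>p\<^sub>I\<close> supported on \<open>I\<close>, and there \<open>Q (h x)\<close> must vanish.\<close>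

lemma Ck_submanifold_projects_onto_cube:
  fixes S :: "(real^'n::finite) set"
  assumes S: "Ck_submanifold k m S" and k: "k \<ge> 1" and ne: "S \<noteq> {}"
  obtains I :: "'n set" and c \<rho> where "card I = m" "0 < \<rho>" "\<rho> \<le> 1" "projects_onto_cube I c \<rho> S"
proof -
  obtain p where p: "p \<in> S" using ne by auto
  obtain U W and h :: "real^'n \<Rightarrow> real^'n" where U: "open U" "p \<in> U" and W: "subspace W" "dim W = m"
    and h: "continuous_on U h" "(h has_derivative (\<lambda>y. y)) (at p)" "\<forall>x\<in>U. h x \<in> W \<longleftrightarrow> x \<in> S"
    by (rule Ck_submanifold_straightening[OF S k p])
  obtain I :: "'n set" and Q :: "real^'n \<Rightarrow> real^'n" where I: "card I = dim W" and Q: "linear Q"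
    "\<forall>x. \<forall>l\<in>I. Q x $ l = 0" "\<forall>x. (\<forall>l\<in>I. x $ l = 0) \<longrightarrow> Q x = x" "\<forall>x. Q x = 0 \<longleftrightarrow> x \<in> W"
    by (rule coordinate_projection_along_subspace[OF W(1)])
  define H where "H x = coordinate_restriction I x + Q (h x)" for x
  have "H p \<in> interior (H ` U)"
    unfolding H_def by (rule coordinate_restriction_add_mem_interior[OF U h(1,2) Q(1-3)])
  moreover have "H p = coordinate_restriction I p" using h(3) U(2) p Q(4) by (simp add: H_def)
  ultimately obtain e where e: "e > 0" "ball (coordinate_restriction I p) e \<subseteq> H ` U"
    by (metis mem_interior)
  have "\<exists>x\<in>S. \<forall>l\<in>I. x $ l = y $ l"
    if y: "y \<in> ball (coordinate_restriction I p) e" "\<forall>l. l \<notin> I \<longrightarrow> y $ l = 0" for y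
  proof -
    obtain x where x: "x \<in> U" "H x = y" using e(2) y(1) by blast
    have "Q (h x) $ l = 0" for l
      using arg_cong[OF x(2), of "\<lambda>z. z $ l"] Q(2) y(2)
      by (cases "l \<in> I") (auto simp: H_def coordinate_restriction_def)
    then have "Q (h x) = 0" by (simp add: vec_eq_iff)
    then have "x \<in> S" using h(3) x(1) Q(4) by blast
    moreover have "\<forall>l\<in>I. x $ l = y $ l"
      using Q(2) by (auto simp: H_def coordinate_restriction_def simp flip: x(2))
    ultimately show ?thesis by blast
  qed
  then obtain \<rho> where "0 < \<rho>" "\<rho> \<le> 1" "projects_onto_cube I p \<rho> S"
    using projects_onto_cubeI[OF e(1)] by metis
  then show ?thesis using that I W(2) by simp
qed

subsection \<open>Averaging over shears\<close>

lemma frac_less_inverse_iff: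
  fixes x :: real
  assumes "L > 0"
  shows "frac x < 1 / real L \<longleftrightarrow> int L dvd \<lfloor>x * real L\<rfloor>"
proof -
  have "\<lfloor>x * real L\<rfloor> div int L = \<lfloor>x\<rfloor>"
    using floor_divide_real_eq_div[of "int L" "x * real L"] assms by simp
  then have "\<lfloor>x * real L\<rfloor> mod int L = \<lfloor>x * real L\<rfloor> - \<lfloor>x\<rfloor> * int L"
    by (simp add: minus_div_mult_eq_mod[symmetric])
  also have "\<dots> = \<lfloor>x * real L - of_int (\<lfloor>x\<rfloor> * int L)\<rfloor>" by (simp only: floor_diff_of_int)
  also have "x * real L - of_int (\<lfloor>x\<rfloor> * int L) = frac x * real L"
    by (simp add: frac_def algebra_simps)
  finally have "int L dvd \<lfloor>x * real L\<rfloor> \<longleftrightarrow> \<lfloor>frac x * real L\<rfloor> = 0" by (simp add: dvd_eq_mod_eq_0)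
  also have "\<dots> \<longleftrightarrow> frac x < 1 / real L"
    using assms by (simp add: floor_eq_iff field_simps)
  finally show ?thesis by simp
qed

lemma ex1_shift_frac_less_inverse:
  fixes x :: real
  assumes "L > 0"
  shows "\<exists>!t. t < L \<and> frac (x + real t / real L) < 1 / real L"
proof -
  have iff: "frac (x + real t / real L) < 1 / real L \<longleftrightarrow> int t mod int L = (- \<lfloor>x * real L\<rfloor>) mod int L"
    for t
  proof -
    have "(x + real t / real L) * real L = x * real L + of_int (int t)"
      using assms by (simp add: algebra_simps)
    then have "\<lfloor>(x + real t / real L) * real L\<rfloor> = \<lfloor>x * real L\<rfloor> + int t"
      by (simp only: floor_add_int[symmetric])
    then show ?thesis
      by (simp add: frac_less_inverse_iff[OF assms] mod_eq_dvd_iff add.commute)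
  qed
  show ?thesis
    unfolding iff
  proof (rule ex1I[of _ "nat ((- \<lfloor>x * real L\<rfloor>) mod int L)"])
    show "nat ((- \<lfloor>x * real L\<rfloor>) mod int L) < L \<and>
        int (nat ((- \<lfloor>x * real L\<rfloor>) mod int L)) mod int L = (- \<lfloor>x * real L\<rfloor>) mod int L"
      using assms by (simp add: nat_less_iff)
    show "t = nat ((- \<lfloor>x * real L\<rfloor>) mod int L)"
      if "t < L \<and> int t mod int L = (- \<lfloor>x * real L\<rfloor>) mod int L" for t
      using that by (metis mod_less nat_int zmod_int)
  qed
qed

lemma card_int_open_interval:
  fixes a b :: real
  assumes "a \<le> b"
  shows "finite {i::int. a < of_int i \<and> of_int i < b}" (is "finite ?S")
    and "real (card {i::int. a < of_int i \<and> of_int i < b}) \<le> b - a + 1"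
proof -
  have eq: "?S = {\<lfloor>a\<rfloor> + 1 .. \<lceil>b\<rceil> - 1}" by (auto simp: floor_less_iff less_ceiling_iff) linarith+
  show "finite ?S" unfolding eq by simp
  show "real (card ?S) \<le> b - a + 1" unfolding eq card_atLeastAtMost_int using assms by linarith
qed

lemma card_nat_open_interval:
  fixes a b :: real
  assumes "a \<le> b"
  shows "finite {c::nat. a < real c \<and> real c < b}" (is "finite ?S")
    and "real (card {c::nat. a < real c \<and> real c < b}) \<le> b - a + 1"
proof -
  have sub: "int ` ?S \<subseteq> {i. a < of_int i \<and> of_int i < b}" by auto
  show "finite ?S" using finite_subset[OF sub card_int_open_interval(1)[OF assms]]
    by (simp add: finite_image_iff)
  have "card ?S \<le> card {i::int. a < of_int i \<and> of_int i < b}"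
    using card_mono[OF card_int_open_interval(1)[OF assms] sub] by (simp add: card_image)
  then show "real (card ?S) \<le> b - a + 1" using card_int_open_interval(2)[OF assms] by linarith
qed

lemma near_integer_progression_bounds:
  fixes \<beta> s P L :: real
  assumes pos: "P > 0" "L \<ge> 1" "s > 0" and c: "0 \<le> c" "c < P"
    and i: "\<bar>\<beta> + c / P * s - of_int i\<bar> < 1 / L"
  shows "\<beta> - 1 < of_int i \<and> of_int i < \<beta> + s + 1"
    and "(of_int i - \<beta>) * P / s - P / (L * s) < c \<and> c < (of_int i - \<beta>) * P / s + P / (L * s)"
proof -
  have "0 \<le> c / P * s" "c / P * s \<le> 1 * s"
    using pos c mult_right_mono[of "c / P" 1 s] by simp_all
  moreover have "1 / L \<le> 1" using pos by simp
  ultimately show "\<beta> - 1 < of_int i \<and> of_int i < \<beta> + s + 1" using i by (auto simp: abs_less_iff)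
  have "c - (of_int i - \<beta>) * P / s = (\<beta> + c / P * s - of_int i) * (P / s)"
    using pos by (simp add: field_simps)
  then have "\<bar>c - (of_int i - \<beta>) * P / s\<bar> = \<bar>\<beta> + c / P * s - of_int i\<bar> * (P / s)"
    using pos by (simp add: abs_mult)
  also have "\<dots> < 1 / L * (P / s)" by (rule mult_strict_right_mono[OF i]) (use pos in auto)
  finally have "\<bar>c - (of_int i - \<beta>) * P / s\<bar> < P / (L * s)" by simp
  then show "(of_int i - \<beta>) * P / s - P / (L * s) < c \<and> c < (of_int i - \<beta>) * P / s + P / (L * s)"
    by (auto simp: abs_less_iff)
qed

lemma card_near_integer_progression_pos:
  fixes \<beta> s :: real
  assumes s: "s \<ge> 1" and L: "L > 0" and P: "real P \<ge> real L * (s + 3)"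
  shows "real (card {c. c < P \<and> (\<exists>i::int. \<bar>\<beta> + real c / real P * s - of_int i\<bar> < 1 / real L)})
    \<le> 9 * real P / real L" (is "real (card ?S) \<le> _")
proof -
  have L1: "real L \<ge> 1" using L by simp
  have "0 < real L * (s + 3)" using s L by (intro mult_pos_pos) auto
  then have P0: "real P > 0" using P by linarith
  define K where "K = {i::int. \<beta> - 1 < of_int i \<and> of_int i < \<beta> + s + 1}"
  define a where "a i = (of_int i - \<beta>) * P / s" for i :: int
  define e where "e = P / (L * s)"
  define E where "E i = {c::nat. a i - e < real c \<and> real c < a i + e}" for i
  have e0: "e \<ge> 0" using s by (simp add: e_def)
  have sub: "?S \<subseteq> (\<Union>i\<in>K. E i)"
  proof
    fix c assume "c \<in> ?S"
    then obtain i :: int where "c < P" and i: "\<bar>\<beta> + real c / real P * s - of_int i\<bar> < 1 / real L"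
      by blast
    then have "i \<in> K" "c \<in> E i"
      using near_integer_progression_bounds[OF P0 L1 _ _ _ i] s
      by (simp_all add: K_def E_def a_def e_def)
    then show "c \<in> (\<Union>i\<in>K. E i)" by blast
  qed
  have fin: "finite K" "finite (E i)" for i
    using s e0 card_int_open_interval(1) card_nat_open_interval(1) by (simp_all add: K_def E_def)
  have "card ?S \<le> card (\<Union>i\<in>K. E i)" by (rule card_mono[OF _ sub]) (use fin in blast)
  also have "\<dots> \<le> (\<Sum>i\<in>K. card (E i))" by (rule card_UN_le[OF fin(1)])
  finally have "real (card ?S) \<le> (\<Sum>i\<in>K. real (card (E i)))" by (simp flip: of_nat_sum)
  also have "\<dots> \<le> (\<Sum>i\<in>K. 2 * e + 1)"
  proof (rule sum_mono)
    fix i show "real (card (E i)) \<le> 2 * e + 1"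
      using card_nat_open_interval(2)[of "a i - e" "a i + e"] e0 by (simp add: E_def)
  qed
  also have "\<dots> \<le> (s + 3) * (2 * e + 1)"
    using card_int_open_interval(2)[of "\<beta> - 1" "\<beta> + s + 1"] s e0
    by (simp add: K_def mult_right_mono)
  also have "\<dots> = 2 * (P / L) + 6 * (P / L) / s + (s + 3)"
    using s L by (simp add: e_def field_simps)
  also have "\<dots> \<le> 2 * (P / L) + 6 * (P / L) + P / L"
  proof -
    have "6 * (P / L) / s \<le> 6 * (P / L) / 1" by (rule divide_left_mono) (use s in auto)
    moreover have "s + 3 \<le> P / L" using P L by (simp add: field_simps)
    ultimately show ?thesis by linarith
  qed
  finally show ?thesis by simp
qed

lemma card_near_integer_progression:
  fixes \<beta> s :: real
  assumes s: "\<bar>s\<bar> \<ge> 1" and L: "L > 0" and P: "real P \<ge> real L * (\<bar>s\<bar> + 3)"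
  shows "real (card {c. c < P \<and> (\<exists>i::int. \<bar>\<beta> + real c / real P * s - of_int i\<bar> < 1 / real L)})
    \<le> 9 * real P / real L"
proof (cases "s \<ge> 0")
  case True
  then show ?thesis using card_near_integer_progression_pos[of s L P \<beta>] assms by simp
next
  case False
  have "(\<exists>i::int. \<bar>\<beta> + real c / real P * s - of_int i\<bar> < 1 / real L) \<longleftrightarrow>
      (\<exists>i::int. \<bar>- \<beta> + real c / real P * (- s) - of_int i\<bar> < 1 / real L)" for c
  proof -
    have "\<bar>\<beta> + real c / real P * s - of_int i\<bar> = \<bar>- \<beta> + real c / real P * (- s) - of_int (- i)\<bar>"
      for i
      by (subst abs_minus_cancel[symmetric]) (simp add: algebra_simps)
    then show ?thesis by (metis minus_minus)
  qed
  then show ?thesis using card_near_integer_progression_pos[of "- s" L P "- \<beta>"] assms False by simp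
qed

lemma card_PiE_le_slices:
  assumes "finite I" "finite A" "l \<in> I" and B: "\<And>g. real (card {c \<in> A. Q (g(l := c))}) \<le> B"
  shows "real (card {a \<in> I \<rightarrow>\<^sub>E A. Q a}) \<le> real (card A) ^ (card I - 1) * B"
proof -
  let ?G = "(I - {l}) \<rightarrow>\<^sub>E A"
  have fin: "finite ?G" using assms(1,2) by (auto intro: finite_PiE)
  have eq: "(I \<rightarrow>\<^sub>E A) = (\<lambda>(y, g). g(l := y)) ` (A \<times> ?G)"
    using PiE_insert_eq[of l "I - {l}" "\<lambda>_. A"] assms(3) by (simp add: insert_absorb)
  have sub: "{a \<in> I \<rightarrow>\<^sub>E A. Q a} \<subseteq> (\<lambda>(g, y). g(l := y)) ` (SIGMA g:?G. {c \<in> A. Q (g(l := c))})"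
    unfolding eq by force
  have "card {a \<in> I \<rightarrow>\<^sub>E A. Q a} \<le> card (SIGMA g:?G. {c \<in> A. Q (g(l := c))})"
    by (rule surj_card_le[OF _ sub]) (use fin assms(2) in auto)
  also have "\<dots> = (\<Sum>g\<in>?G. card {c \<in> A. Q (g(l := c))})"
    by (rule card_SigmaI) (use fin assms(2) in auto)
  finally have "real (card {a \<in> I \<rightarrow>\<^sub>E A. Q a}) \<le> (\<Sum>g\<in>?G. real (card {c \<in> A. Q (g(l := c))}))"
    by (simp flip: of_nat_sum)
  also have "\<dots> \<le> (\<Sum>g\<in>?G. B)" by (rule sum_mono) (rule B)
  also have "\<dots> = real (card A) ^ (card I - 1) * B" using assms(1,3) by (simp add: card_PiE)
  finally show ?thesis .
qed

definition good_shears :: "'i set \<Rightarrow> nat \<Rightarrow> nat \<Rightarrow> real \<Rightarrow> ('i \<Rightarrow> real) \<Rightarrow> (('i \<Rightarrow> nat) \<times> nat) set" where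
  "good_shears I P L x s = (SIGMA a:I \<rightarrow>\<^sub>E {..<P}.
     {t. t < L \<and> frac (x + (\<Sum>l\<in>I. real (a l) / real P * s l) + real t / real L) < 1 / real L})"

lemma good_shears_subset: "good_shears I P L x s \<subseteq> (I \<rightarrow>\<^sub>E {..<P}) \<times> {..<L}"
  by (auto simp: good_shears_def)

lemma card_good_shears:
  assumes "finite I" "L > 0"
  shows "card (good_shears I P L x s) = P ^ card I"
proof -
  have "card {t. t < L \<and> frac (y + real t / real L) < 1 / real L} = 1" for y
    using ex1_shift_frac_less_inverse[OF assms(2), of y]
    by (simp add: card_1_singleton_iff set_eq_iff) metis
  then show ?thesis using assms(1) by (simp add: good_shears_def card_PiE finite_PiE)
qed

lemma card_shears_near_integer:
  fixes \<beta> :: real and s :: "'i \<Rightarrow> real"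
  assumes I: "finite I" "l \<in> I" and L: "L > 0" and sl: "\<bar>s l\<bar> \<ge> 1"
    and P: "real P \<ge> real L * (\<bar>s l\<bar> + 3)"
  shows "real (card {a \<in> I \<rightarrow>\<^sub>E {..<P}.
      \<exists>i::int. \<bar>\<beta> + (\<Sum>l\<in>I. real (a l) / real P * s l) - of_int i\<bar> < 1 / real L})
    \<le> 9 * real P ^ card I / real L"
proof -
  define near where
    "near a \<longleftrightarrow> (\<exists>i::int. \<bar>\<beta> + (\<Sum>l\<in>I. real (a l) / real P * s l) - of_int i\<bar> < 1 / real L)"
    for a
  have "real (card {a \<in> I \<rightarrow>\<^sub>E {..<P}. near a})
      \<le> real (card {..<P}) ^ (card I - 1) * (9 * real P / real L)"
  proof (rule card_PiE_le_slices[OF I(1) finite_lessThan I(2)])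
    fix g :: "'i \<Rightarrow> nat"
    define \<gamma> where "\<gamma> = \<beta> + (\<Sum>l'\<in>I - {l}. real (g l') / real P * s l')"
    have "\<beta> + (\<Sum>l'\<in>I. real ((g(l := c)) l') / real P * s l') = \<gamma> + real c / real P * s l" for c
      using I by (simp add: \<gamma>_def sum.remove[of I l])
    then show "real (card {c \<in> {..<P}. near (g(l := c))}) \<le> 9 * real P / real L"
      using card_near_integer_progression[OF sl L P, of \<gamma>] by (simp add: near_def)
  qed
  also have "\<dots> = 9 * (real P ^ (card I - 1) * real P) / real L" by simp
  also have "real P ^ (card I - 1) * real P = real P ^ card I"
    using I by (intro power_minus_mult) (auto simp: card_gt_0_iff)
  finally show ?thesis by (simp only: near_def)
qed

lemma card_good_shears_Int:
  fixes x x' :: real and s s' :: "'i \<Rightarrow> real"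
  assumes I: "finite I" "l \<in> I" and L: "L > 0" and sl: "\<bar>s l - s' l\<bar> \<ge> 1"
    and P: "real P \<ge> real L * (\<bar>s l - s' l\<bar> + 3)"
  shows "real (card (good_shears I P L x s \<inter> good_shears I P L x' s'))
      \<le> 9 * real P ^ card I / real L"
proof -
  define X where "X a = x + (\<Sum>l\<in>I. real (a l) / real P * s l)" for a
  define X' where "X' a = x' + (\<Sum>l\<in>I. real (a l) / real P * s' l)" for a
  let ?S = "good_shears I P L x s \<inter> good_shears I P L x' s'"
  let ?T = "{a \<in> I \<rightarrow>\<^sub>E {..<P}. \<exists>i::int. \<bar>X a - X' a - of_int i\<bar> < 1 / real L}"
  have "inj_on fst ?S"
  proof (rule inj_onI)
    fix \<theta> \<theta>' assume "\<theta> \<in> ?S" "\<theta>' \<in> ?S" "fst \<theta> = fst \<theta>'"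
    then obtain a t t' where \<theta>: "\<theta> = (a, t)" "\<theta>' = (a, t')" and t: "t < L" "t' < L"
      "frac (X a + real t / real L) < 1 / real L" "frac (X a + real t' / real L) < 1 / real L"
      by (cases \<theta>, cases \<theta>') (auto simp: good_shears_def X_def)
    have "t = t'" using ex1_shift_frac_less_inverse[OF L, of "X a"] t by blast
    then show "\<theta> = \<theta>'" using \<theta> by simp
  qed
  moreover have "fst ` ?S \<subseteq> ?T"
  proof
    fix a assume "a \<in> fst ` ?S"
    then obtain t where a: "a \<in> I \<rightarrow>\<^sub>E {..<P}"
      and good: "frac (X a + real t / real L) < 1 / real L"
        "frac (X' a + real t / real L) < 1 / real L"
      by (auto simp: good_shears_def X_def X'_def)
    let ?u = "X a + real t / real L" and ?v = "X' a + real t / real L"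
    have "X a - X' a - of_int (\<lfloor>?u\<rfloor> - \<lfloor>?v\<rfloor>) = frac ?u - frac ?v" by (simp add: frac_def)
    moreover have "\<bar>frac ?u - frac ?v\<bar> < 1 / real L"
      using good frac_ge_0[of ?u] frac_ge_0[of ?v] by linarith
    ultimately have "\<exists>i::int. \<bar>X a - X' a - of_int i\<bar> < 1 / real L" by metis
    then show "a \<in> ?T" using a by simp
  qed
  ultimately have "card ?S \<le> card ?T" using I by (intro card_inj_on_le) (simp_all add: finite_PiE)
  moreover have "X a - X' a = x - x' + (\<Sum>l\<in>I. real (a l) / real P * (s l - s' l))" for a
    by (simp add: X_def X'_def sum_subtractf right_diff_distrib)
  ultimately show ?thesis
    using card_shears_near_integer[where s = "\<lambda>l. s l - s' l" and \<beta> = "x - x'", OF I L sl P] by simp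
qed

text \<open>Sum \<open>1 \<ge> 2 g - g\<^sup>2\<close> over the union, \<open>g\<close> being the number of sets containing a point.\<close>

lemma card_UN_second_moment:
  assumes "finite Y" "\<And>y. y \<in> Y \<Longrightarrow> finite (A y)"
  shows "2 * (\<Sum>y\<in>Y. real (card (A y))) - (\<Sum>y\<in>Y. \<Sum>y'\<in>Y. real (card (A y \<inter> A y')))
      \<le> real (card (\<Union>y\<in>Y. A y))"
proof -
  let ?U = "\<Union>y\<in>Y. A y"
  have fin: "finite ?U" using assms by auto
  have count: "(\<Sum>x\<in>?U. of_bool (x \<in> B)) = real (card B)" if "B \<subseteq> ?U" for B
    using that fin by (simp add: of_bool_def sum.If_cases Int_absorb1)
  define g where "g x = (\<Sum>y\<in>Y. of_bool (x \<in> A y) :: real)" for x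
  have first_moment: "(\<Sum>x\<in>?U. g x) = (\<Sum>y\<in>Y. real (card (A y)))"
    unfolding g_def by (subst sum.swap, rule sum.cong) (auto intro!: count)
  have "(\<Sum>x\<in>?U. g x * g x) = (\<Sum>x\<in>?U. \<Sum>y\<in>Y. \<Sum>y'\<in>Y. of_bool (x \<in> A y \<inter> A y'))"
    unfolding g_def sum_product by (intro sum.cong refl) auto
  also have "\<dots> = (\<Sum>y\<in>Y. \<Sum>y'\<in>Y. \<Sum>x\<in>?U. of_bool (x \<in> A y \<inter> A y'))"
    by (subst sum.swap) (intro sum.cong refl sum.swap)
  also have "\<dots> = (\<Sum>y\<in>Y. \<Sum>y'\<in>Y. real (card (A y \<inter> A y')))"
    by (intro sum.cong refl count) auto
  finally have second_moment: "(\<Sum>x\<in>?U. g x * g x) = (\<Sum>y\<in>Y. \<Sum>y'\<in>Y. real (card (A y \<inter> A y')))" .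
  have "0 \<le> (\<Sum>x\<in>?U. (1 - g x) * (1 - g x))" by (intro sum_nonneg) simp
  also have "\<dots> = (\<Sum>x\<in>?U. 1 - 2 * g x + g x * g x)" by (rule sum.cong) (auto simp: algebra_simps)
  also have "\<dots> = real (card ?U) - 2 * (\<Sum>x\<in>?U. g x) + (\<Sum>x\<in>?U. g x * g x)"
    by (simp add: sum.distrib sum_subtractf sum_distrib_left)
  finally show ?thesis unfolding first_moment second_moment by linarith
qed

lemma card_UN_ge_half_sum:
  fixes q \<delta> :: real
  assumes Y: "finite Y" and A: "\<And>y. y \<in> Y \<Longrightarrow> finite (A y)" "\<And>y. y \<in> Y \<Longrightarrow> real (card (A y)) = q"
    and \<delta>: "\<And>y y'. y \<in> Y \<Longrightarrow> y' \<in> Y \<Longrightarrow> y \<noteq> y' \<Longrightarrow> real (card (A y \<inter> A y')) \<le> \<delta>"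
    and small: "0 \<le> \<delta>" "real (card Y) * \<delta> \<le> q / 2"
  shows "real (card Y) * q / 2 \<le> real (card (\<Union>y\<in>Y. A y))"
proof -
  have "(\<Sum>y\<in>Y. \<Sum>y'\<in>Y. real (card (A y \<inter> A y'))) \<le> (\<Sum>y\<in>Y. q + q / 2)"
  proof (rule sum_mono)
    fix y assume y: "y \<in> Y"
    have "(\<Sum>y'\<in>Y. real (card (A y \<inter> A y'))) = q + (\<Sum>y'\<in>Y - {y}. real (card (A y \<inter> A y')))"
      using y Y A(2) by (simp add: sum.remove[of Y y])
    also have "(\<Sum>y'\<in>Y - {y}. real (card (A y \<inter> A y'))) \<le> (\<Sum>y'\<in>Y - {y}. \<delta>)"
      by (rule sum_mono) (use \<delta> y in auto)
    also have "\<dots> \<le> real (card Y) * \<delta>"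
      using small(1) by (simp add: mult_right_mono card_Diff1_le)
    also have "\<dots> \<le> q / 2" by (rule small(2))
    finally show "(\<Sum>y'\<in>Y. real (card (A y \<inter> A y'))) \<le> q + q / 2" by simp
  qed
  then show ?thesis
    using card_UN_second_moment[of Y A] Y A by (simp add: algebra_simps)
qed

lemma exists_point_in_many_sets:
  fixes c :: real
  assumes \<Theta>: "finite \<Theta>" "\<Theta> \<noteq> {}" and Z: "finite Z"
    and E: "\<And>z. z \<in> Z \<Longrightarrow> E z \<subseteq> \<Theta>" "\<And>z. z \<in> Z \<Longrightarrow> c \<le> real (card (E z))"
  shows "\<exists>\<theta>\<in>\<Theta>. real (card Z) * c / real (card \<Theta>) \<le> real (card {z \<in> Z. \<theta> \<in> E z})"
proof (rule ccontr)
  assume "\<not> ?thesis"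
  then have lt: "real (card {z \<in> Z. \<theta> \<in> E z}) < real (card Z) * c / real (card \<Theta>)" if "\<theta> \<in> \<Theta>" for \<theta>
    using that by force
  have "(\<Sum>\<theta>\<in>\<Theta>. card {z \<in> Z. \<theta> \<in> E z}) = (\<Sum>z\<in>Z. card (E z))"
    by (rule sum_multicount_gen[OF \<Theta>(1) Z]) (use E(1) in \<open>simp add: Collect_conj_eq Int_absorb1\<close>)
  then have "(\<Sum>\<theta>\<in>\<Theta>. real (card {z \<in> Z. \<theta> \<in> E z})) = (\<Sum>z\<in>Z. real (card (E z)))"
    by (simp flip: of_nat_sum)
  moreover have "(\<Sum>\<theta>\<in>\<Theta>. real (card {z \<in> Z. \<theta> \<in> E z})) < (\<Sum>\<theta>\<in>\<Theta>. real (card Z) * c / real (card \<Theta>))"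
    by (rule sum_strict_mono[OF \<Theta> lt])
  moreover have "(\<Sum>\<theta>\<in>\<Theta>. real (card Z) * c / real (card \<Theta>)) = (\<Sum>z\<in>Z. c)"
    using \<Theta> by simp
  moreover have "(\<Sum>z\<in>Z. c) \<le> (\<Sum>z\<in>Z. real (card (E z)))" by (rule sum_mono) (rule E(2))
  ultimately show False by linarith
qed

lemma card_UN_PiE_good_shears:
  fixes F :: "'y \<Rightarrow> 'j \<Rightarrow> real" and s :: "'y \<Rightarrow> 'i \<Rightarrow> real"
  assumes fin: "finite Y" "finite I" "finite J" and L: "L > 0"
    and sep: "\<And>y y'. y \<in> Y \<Longrightarrow> y' \<in> Y \<Longrightarrow> y \<noteq> y' \<Longrightarrow> \<exists>l\<in>I. \<bar>s y l - s y' l\<bar> \<ge> 1"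
    and LY: "2 * 9 ^ card J * real (card Y) \<le> real L ^ card J"
    and P: "\<And>y y' l. y \<in> Y \<Longrightarrow> y' \<in> Y \<Longrightarrow> l \<in> I \<Longrightarrow> real L * (\<bar>s y l - s y' l\<bar> + 3) \<le> real P"
  shows "real (card Y) * (real P ^ card I) ^ card J / 2
    \<le> real (card (\<Union>y\<in>Y. \<Pi>\<^sub>E j\<in>J. good_shears I P L (F y j) (s y)))"
proof -
  define q where "q = (real P ^ card I) ^ card J"
  define A where "A y = (\<Pi>\<^sub>E j\<in>J. good_shears I P L (F y j) (s y))" for y
  have "finite (good_shears I P L x r)" for x r
    using finite_subset[OF good_shears_subset[of I P L x r]] fin by (simp add: finite_PiE)
  then have fin_A: "finite (A y)" for y using fin by (simp add: A_def finite_PiE)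
  have card_A: "real (card (A y)) = q" for y
    using fin L by (simp add: A_def q_def card_PiE card_good_shears)
  have card_Int: "real (card (A y \<inter> A y')) \<le> 9 ^ card J * q / real L ^ card J"
    if y: "y \<in> Y" "y' \<in> Y" "y \<noteq> y'" for y y'
  proof -
    obtain l where l: "l \<in> I" "\<bar>s y l - s y' l\<bar> \<ge> 1" using sep[OF y] by blast
    have "real (card (A y \<inter> A y'))
        = (\<Prod>j\<in>J. real (card (good_shears I P L (F y j) (s y) \<inter> good_shears I P L (F y' j) (s y'))))"
      using fin by (simp add: A_def PiE_Int card_PiE)
    also have "\<dots> \<le> (\<Prod>j\<in>J. 9 * real P ^ card I / real L)"
      using card_good_shears_Int[where s = "s y" and s' = "s y'",
          OF fin(2) l(1) L l(2) P[OF y(1,2) l(1)]]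
      by (intro prod_mono) simp
    also have "\<dots> = 9 ^ card J * q / real L ^ card J"
      by (simp add: q_def power_divide power_mult_distrib)
    finally show ?thesis .
  qed
  have q0: "0 \<le> q" by (simp add: q_def)
  have "real (card Y) * (9 ^ card J * q / real L ^ card J) \<le> q / 2"
  proof -
    have "2 * 9 ^ card J * real (card Y) * q \<le> real L ^ card J * q"
      using LY q0 by (rule mult_right_mono)
    then show ?thesis using L by (simp add: field_simps)
  qed
  then show ?thesis
    using card_UN_ge_half_sum[OF fin(1) fin_A card_A card_Int] q0
    by (simp add: A_def q_def)
qed

lemma exists_good_shear_for_many:
  fixes F :: "'z \<Rightarrow> 'y \<Rightarrow> 'j \<Rightarrow> real" and s :: "'z \<Rightarrow> 'y \<Rightarrow> 'i \<Rightarrow> real"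
  assumes fin: "finite Z" "finite Y" "finite I" "finite J" and L: "L > 0"
    and sep: "\<And>z y y'. z \<in> Z \<Longrightarrow> y \<in> Y \<Longrightarrow> y' \<in> Y \<Longrightarrow> y \<noteq> y' \<Longrightarrow> \<exists>l\<in>I. \<bar>s z y l - s z y' l\<bar> \<ge> 1"
    and LY: "2 * 9 ^ card J * real (card Y) \<le> real L ^ card J"
  obtains P \<theta> where "\<theta> \<in> (\<Pi>\<^sub>E j\<in>J. (I \<rightarrow>\<^sub>E {..<P}) \<times> {..<L})"
    "real (card Z) * real (card Y) / (2 * real L ^ card J) \<le>
      real (card {z \<in> Z. \<theta> \<in> (\<Union>y\<in>Y. \<Pi>\<^sub>E j\<in>J. good_shears I P L (F z y j) (s z y))})"
proof -
  let ?bound = "\<lambda>(z, y, y', l). real L * (\<bar>s z y l - s z y' l\<bar> + 3)"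
  have "bdd_above (?bound ` (Z \<times> Y \<times> Y \<times> I))"
    using fin by (intro bdd_above_finite) simp
  then obtain B where "\<forall>x\<in>?bound ` (Z \<times> Y \<times> Y \<times> I). x \<le> B"
    unfolding bdd_above_def by blast
  then have B: "real L * (\<bar>s z y l - s z y' l\<bar> + 3) \<le> B"
    if "z \<in> Z" "y \<in> Y" "y' \<in> Y" "l \<in> I" for z y y' l
    using that by simp
  obtain P where P: "real P \<ge> max 1 B" using real_arch_simple by blast
  define \<Theta> where "\<Theta> = (\<Pi>\<^sub>E j\<in>J. (I \<rightarrow>\<^sub>E {..<P}) \<times> {..<L})"
  define E where "E z = (\<Union>y\<in>Y. \<Pi>\<^sub>E j\<in>J. good_shears I P L (F z y j) (s z y))" for z
  define q where "q = (real P ^ card I) ^ card J"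
  have q0: "q > 0" using P by (simp add: q_def)
  have fin_\<Theta>: "finite \<Theta>" using fin by (simp add: \<Theta>_def finite_PiE)
  have card_\<Theta>: "real (card \<Theta>) = q * real L ^ card J"
    using fin by (simp add: \<Theta>_def q_def card_PiE card_cartesian_product power_mult_distrib)
  then have ne: "\<Theta> \<noteq> {}" using q0 L by auto
  have "E z \<subseteq> \<Theta>" for z
    unfolding E_def \<Theta>_def by (intro UN_least PiE_mono good_shears_subset)
  moreover have "real (card Y) * q / 2 \<le> real (card (E z))" if "z \<in> Z" for z
    unfolding E_def q_def
  proof (rule card_UN_PiE_good_shears[OF fin(2,3,4) L sep[OF that] LY])
    show "real L * (\<bar>s z y l - s z y' l\<bar> + 3) \<le> real P" if "y \<in> Y" "y' \<in> Y" "l \<in> I" for y y' l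
      using B[OF \<open>z \<in> Z\<close> that] P by linarith
  qed
  ultimately obtain \<theta> where "\<theta> \<in> \<Theta>"
    "real (card Z) * (real (card Y) * q / 2) / real (card \<Theta>) \<le> real (card {z \<in> Z. \<theta> \<in> E z})"
    using exists_point_in_many_sets[OF fin_\<Theta> ne fin(1), of E "real (card Y) * q / 2"] by blast
  moreover have "real (card Z) * (real (card Y) * q / 2) / real (card \<Theta>)
      = real (card Z) * real (card Y) / (2 * real L ^ card J)"
    using q0 by (simp add: card_\<Theta>)
  ultimately show ?thesis using that[of \<theta> P] by (simp only: \<Theta>_def E_def)
qed

lemma exists_shear_with_many_good_cells:
  fixes F :: "'z \<Rightarrow> 'y \<Rightarrow> 'j \<Rightarrow> real" and s :: "'z \<Rightarrow> 'y \<Rightarrow> 'i \<Rightarrow> real"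
  assumes fin: "finite Z" "finite Y" "finite I" "finite J" and L: "L > 0"
    and sep: "\<And>z y y'. z \<in> Z \<Longrightarrow> y \<in> Y \<Longrightarrow> y' \<in> Y \<Longrightarrow> y \<noteq> y' \<Longrightarrow> \<exists>l\<in>I. \<bar>s z y l - s z y' l\<bar> \<ge> 1"
    and LY: "2 * 9 ^ card J * real (card Y) \<le> real L ^ card J"
  obtains \<tau> :: "'j \<Rightarrow> real" and a :: "'j \<Rightarrow> 'i \<Rightarrow> real" where
    "\<forall>j\<in>J. 0 \<le> \<tau> j \<and> \<tau> j \<le> 1" "\<forall>j\<in>J. \<forall>l\<in>I. 0 \<le> a j l \<and> a j l \<le> 1"
    "real (card Z) * real (card Y) / (2 * real L ^ card J) \<le> real (card {z \<in> Z. \<exists>y\<in>Y. \<forall>j\<in>J.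
      frac (F z y j + (\<Sum>l\<in>I. a j l * s z y l) + \<tau> j) < 1 / real L})"
proof -
  obtain P \<theta> where \<theta>: "\<theta> \<in> (\<Pi>\<^sub>E j\<in>J. (I \<rightarrow>\<^sub>E {..<P}) \<times> {..<L})" and many:
    "real (card Z) * real (card Y) / (2 * real L ^ card J) \<le>
      real (card {z \<in> Z. \<theta> \<in> (\<Union>y\<in>Y. \<Pi>\<^sub>E j\<in>J. good_shears I P L (F z y j) (s z y))})"
    (is "_ \<le> real (card ?good)")
    by (rule exists_good_shear_for_many[OF fin L sep LY])
  define \<tau> where "\<tau> j = real (snd (\<theta> j)) / real L" for j
  define a where "a j l = real (fst (\<theta> j) l) / real P" for j l
  have \<theta>_mem: "fst (\<theta> j) \<in> I \<rightarrow>\<^sub>E {..<P}" "snd (\<theta> j) < L" if "j \<in> J" for j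
    using PiE_mem[OF \<theta> that] by auto
  show ?thesis
  proof (rule that[of \<tau> a])
    show "\<forall>j\<in>J. 0 \<le> \<tau> j \<and> \<tau> j \<le> 1"
    proof
      fix j assume "j \<in> J"
      then show "0 \<le> \<tau> j \<and> \<tau> j \<le> 1" using \<theta>_mem(2)[of j] by (simp add: \<tau>_def)
    qed
    show "\<forall>j\<in>J. \<forall>l\<in>I. 0 \<le> a j l \<and> a j l \<le> 1"
    proof (intro ballI)
      fix j l assume "j \<in> J" "l \<in> I"
      then show "0 \<le> a j l \<and> a j l \<le> 1"
        using PiE_mem[OF \<theta>_mem(1), of j l] by (simp add: a_def)
    qed
    let ?near = "{z \<in> Z. \<exists>y\<in>Y. \<forall>j\<in>J. frac (F z y j + (\<Sum>l\<in>I. a j l * s z y l) + \<tau> j) < 1 / real L}"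
    have "?good \<subseteq> ?near" by (force simp: good_shears_def \<tau>_def a_def PiE_iff)
    then have "card ?good \<le> card ?near" using fin(1) by (intro card_mono) auto
    then show "real (card Z) * real (card Y) / (2 * real L ^ card J) \<le> real (card ?near)"
      using many by linarith
  qed
qed

subsection \<open>Shears\<close>

definition shear_field :: "'n::finite set \<Rightarrow> (real^'n \<Rightarrow> real^'n) \<Rightarrow> bool" where
  "shear_field I G \<longleftrightarrow>
     (\<forall>x. \<forall>l\<in>I. G x $ l = 0) \<and> (\<forall>x y. (\<forall>l\<in>I. x $ l = y $ l) \<longrightarrow> G x = G y)"

lemma shear_field_nth: "shear_field I G \<Longrightarrow> l \<in> I \<Longrightarrow> G x $ l = 0"
  by (simp add: shear_field_def)

lemma shear_field_cong: "shear_field I G \<Longrightarrow> (\<And>l. l \<in> I \<Longrightarrow> x $ l = y $ l) \<Longrightarrow> G x = G y"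
  by (simp add: shear_field_def)

lemma shear_field_scaleR:
  assumes "\<And>l. l \<in> I \<Longrightarrow> v $ l = 0" "\<And>x y. (\<And>l. l \<in> I \<Longrightarrow> x $ l = y $ l) \<Longrightarrow> g x = g y"
  shows "shear_field I (\<lambda>x. g x *\<^sub>R v)"
  unfolding shear_field_def
proof (intro conjI allI ballI impI)
  show "(g x *\<^sub>R v) $ l = 0" if "l \<in> I" for x l using assms(1) that by simp
  show "g x *\<^sub>R v = g y *\<^sub>R v" if "\<forall>l\<in>I. x $ l = y $ l" for x y
    using assms(2)[of x y] that by simp
qed

lemma shear_field_add:
  assumes "shear_field I F" "shear_field I G"
  shows "shear_field I (\<lambda>x. F x + G x)"
  unfolding shear_field_def
proof (intro conjI allI ballI impI)
  show "(F x + G x) $ l = 0" if "l \<in> I" for x l using assms[THEN shear_field_nth] that by simp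
  show "F x + G x = F y + G y" if "\<forall>l\<in>I. x $ l = y $ l" for x y
    using shear_field_cong[OF assms(1), of x y] shear_field_cong[OF assms(2), of x y] that by simp
qed

lemma shear_field_sum:
  assumes "finite S" "\<And>t. t \<in> S \<Longrightarrow> shear_field I (G t)"
  shows "shear_field I (\<lambda>x. \<Sum>t\<in>S. G t x)"
  using assms
proof (induction S)
  case empty
  then show ?case by (simp add: shear_field_def)
qed (simp add: shear_field_add)

lemma Ck_diffeo_on_shear:
  assumes G: "shear_field I G" and Ck: "Ck_on k UNIV G"
  shows "Ck_diffeo_on k UNIV UNIV (\<lambda>x. x + G x)"
proof (rule Ck_diffeo_onI[where g = "\<lambda>x. x + - G x"])
  have "linear (uminus :: real^'a \<Rightarrow> real^'a)" by (rule linear_uminus)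
  then have "Ck_on k UNIV (\<lambda>x. - G x)"
    using Ck_on_compose[OF open_UNIV open_UNIV Ck_on_linear Ck] by blast
  then show "Ck_on k UNIV (\<lambda>x. x + - G x)"
    by (rule Ck_on_add[OF open_UNIV Ck_on_linear[OF linear_ident]])
  show "Ck_on k UNIV (\<lambda>x. x + G x)"
    by (rule Ck_on_add[OF open_UNIV Ck_on_linear[OF linear_ident] Ck])
  have "G (x + G x) = G x" "G (x + - G x) = G x" for x
    using shear_field_nth[OF G] by (auto intro: shear_field_cong[OF G])
  then show "x + G x + - G (x + G x) = x" "x + - G x + G (x + - G x) = x" for x by simp_all
qed auto

lemma Ck_close_shear:
  assumes "shear_field I G" "Ck_norm_le k \<delta> G" "\<delta> < \<epsilon>"
  shows "Ck_close k \<epsilon> S ((\<lambda>x. x + G x) ` S)"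
  using assms Ck_diffeo_on_shear[OF assms(1)] unfolding Ck_close_def Ck_norm_le_def
  by (intro exI[of _ "\<lambda>x. x + G x"] exI[of _ \<delta>]) simp

definition local_bump :: "nat \<Rightarrow> 'n::finite set \<Rightarrow> real \<Rightarrow> real^'n \<Rightarrow> real^'n \<Rightarrow> real^'n \<Rightarrow> real^'n" where
  "local_bump k I r p v x = cube_bump k I ((x - p) /\<^sub>R r) *\<^sub>R v"

lemma local_bump_center [simp]: "local_bump k I r p v p = v"
  by (simp add: local_bump_def)

lemma local_bump_eq_0:
  assumes "l \<in> I" "0 < r" "r < \<bar>x $ l - p $ l\<bar>"
  shows "local_bump k I r p v x = 0"
proof -
  have "cube_bump k I ((x - p) /\<^sub>R r) = 0"
    using assms
    by (intro cube_bump_eq_0[of l]) (simp_all add: abs_mult divide_inverse[symmetric] field_simps)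
  then show ?thesis by (simp add: local_bump_def)
qed

lemma shear_field_local_bump: "(\<And>l. l \<in> I \<Longrightarrow> v $ l = 0) \<Longrightarrow> shear_field I (local_bump k I r p v)"
  unfolding local_bump_def by (intro shear_field_scaleR cube_bump_cong) simp_all

lemma shear_interpolation:
  fixes X :: "(real^'n::finite) set" and v :: "real^'n \<Rightarrow> real^'n"
  assumes bump: "\<And>v. Ck_norm_le k (M * norm v) (\<lambda>x. cube_bump k I x *\<^sub>R (v :: real^'n))"
    and X: "finite X" "\<And>x y. x \<in> X \<Longrightarrow> y \<in> X \<Longrightarrow> x \<noteq> y \<Longrightarrow> \<exists>l\<in>I. 2 * r < \<bar>x $ l - y $ l\<bar>"
    and r: "0 < r" "r \<le> 1" and \<eta>: "0 \<le> \<eta>" "\<And>x. x \<in> X \<Longrightarrow> norm (v x) \<le> \<eta>"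
    and v_I: "\<And>x l. x \<in> X \<Longrightarrow> l \<in> I \<Longrightarrow> v x $ l = 0"
  obtains G where "shear_field I G" "Ck_norm_le k (M * \<eta> / r ^ k) G" "\<forall>x\<in>X. G x = v x"
proof -
  define G where "G x = (\<Sum>p\<in>X. local_bump k I r p (v p) x)" for x
  define A where "A p = {x::real^'n. \<forall>l\<in>I. \<bar>x $ l - p $ l\<bar> \<le> r}" for p
  have M: "0 \<le> M" using bump by (rule Ck_norm_le_scaleR_bound_nonneg)
  have disjoint: "x = y" if xy: "x \<in> X" "y \<in> X" "p \<in> A x" "p \<in> A y" for x y p
  proof (rule ccontr)
    assume "x \<noteq> y"
    then obtain l where "l \<in> I" "2 * r < \<bar>x $ l - y $ l\<bar>" using X(2) xy by blast
    moreover have "\<bar>p $ l - x $ l\<bar> \<le> r" "\<bar>p $ l - y $ l\<bar> \<le> r" using xy \<open>l \<in> I\<close> by (auto simp: A_def)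
    ultimately show False by linarith
  qed
  have outside: "local_bump k I r p (v p) x = 0" if "x \<notin> A p" for p x
    using that local_bump_eq_0[OF _ r(1)] by (auto simp: A_def not_le)
  have "shear_field I G"
    unfolding G_def using v_I by (intro shear_field_sum X(1) shear_field_local_bump)
  moreover have "Ck_norm_le k (M * \<eta> / r ^ k) G"
    unfolding G_def
  proof (rule Ck_norm_le_sum_disjoint_supports[OF X(1)])
    show "0 \<le> M * \<eta> / r ^ k" using M \<eta> r by simp
    show "disjoint_family_on A X" using disjoint by (auto simp: disjoint_family_on_def)
    show "closed (A p)" for p
    proof -
      have "A p = (\<Inter>l\<in>I. {x. \<bar>x $ l - p $ l\<bar> \<le> r})" by (auto simp: A_def)
      then show ?thesis by (auto intro!: closed_INT closed_Collect_le continuous_intros)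
    qed
    show "Ck_norm_le k (M * \<eta> / r ^ k) (local_bump k I r p (v p))" if "p \<in> X" for p
      unfolding local_bump_def using M r \<eta>(2)[OF that]
      by (intro Ck_norm_le_mono[OF Ck_norm_le_rescale[OF r bump]] divide_right_mono mult_left_mono)
         auto
  qed (rule outside)
  moreover have "G x = v x" if x: "x \<in> X" for x
  proof -
    have "local_bump k I r p (v p) x = 0" if "p \<in> X - {x}" for p
      using disjoint[of x p x] x that r by (intro outside) (auto simp: A_def)
    then show ?thesis unfolding G_def using x X(1) by (simp add: sum.remove)
  qed
  ultimately show ?thesis using that by blast
qed

subsection \<open>Moving points of the manifold to lattice points\<close>

lemma scaled_lattice_nth_eq:
  "x \<in> scaled_lattice R \<Longrightarrow> of_int \<lfloor>R * x $ i\<rfloor> = R * x $ i"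
  by (auto simp: scaled_lattice_def)

lemma finite_bounded_Int_scaled_lattice:
  fixes S :: "(real^'n::finite) set"
  assumes "bounded S" "R > 0"
  shows "finite (S \<inter> scaled_lattice R)"
proof -
  obtain B where B: "\<And>x. x \<in> S \<Longrightarrow> norm x \<le> B" using assms(1) bounded_iff by metis
  let ?f = "\<lambda>x::real^'n. \<lambda>i. \<lfloor>R * x $ i\<rfloor>"
  have "inj_on ?f (S \<inter> scaled_lattice R)"
  proof (rule inj_onI)
    fix x y assume xy: "x \<in> S \<inter> scaled_lattice R" "y \<in> S \<inter> scaled_lattice R" "?f x = ?f y"
    have "R * x $ i = R * y $ i" for i
      using xy scaled_lattice_nth_eq[of x R i] scaled_lattice_nth_eq[of y R i] by (metis Int_iff)
    then show "x = y" using assms(2) by (simp add: vec_eq_iff)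
  qed
  moreover have "?f ` (S \<inter> scaled_lattice R) \<subseteq> (\<Pi>\<^sub>E i\<in>UNIV. {\<lfloor>- (R * B)\<rfloor>..\<lfloor>R * B\<rfloor>})"
  proof (clarsimp simp: PiE_UNIV_domain)
    fix x i assume "x \<in> S"
    then have "\<bar>x $ i\<bar> \<le> B" using B order_trans[OF component_le_norm_cart] by blast
    then have "\<bar>R * x $ i\<bar> \<le> R * B" using assms(2) by (simp add: abs_mult)
    then show "\<lfloor>- (R * B)\<rfloor> \<le> \<lfloor>R * x $ i\<rfloor> \<and> \<lfloor>R * x $ i\<rfloor> \<le> \<lfloor>R * B\<rfloor>"
      by (auto intro!: floor_mono)
  qed
  ultimately show ?thesis by (rule inj_on_finite) (simp add: finite_PiE)
qed

lemma shear_into_lattice: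
  fixes X :: "(real^'n::finite) set"
  assumes bump: "\<And>v. Ck_norm_le k (M * norm v) (\<lambda>x. cube_bump k I x *\<^sub>R (v :: real^'n))"
    and X: "finite X" "\<And>x y. x \<in> X \<Longrightarrow> y \<in> X \<Longrightarrow> x \<noteq> y \<Longrightarrow> \<exists>l\<in>I. 2 * r < \<bar>x $ l - y $ l\<bar>"
    and r: "0 < r" "r \<le> 1" and pos: "R > 0" "L > 0"
    and X_I: "\<And>x l. x \<in> X \<Longrightarrow> l \<in> I \<Longrightarrow> R * x $ l \<in> \<int>"
    and X_J: "\<And>x j. x \<in> X \<Longrightarrow> j \<notin> I \<Longrightarrow> frac (R * x $ j) < 1 / L"
  obtains G where "shear_field I G" "Ck_norm_le k (M * (real CARD('n) / (L * R)) / r ^ k) G"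
    "\<forall>x\<in>X. x + G x \<in> scaled_lattice R"
proof -
  define v :: "real^'n \<Rightarrow> real^'n" where "v x = (\<chi> j. if j \<in> I then 0 else - frac (R * x $ j) / R)"
    for x
  have norm_v: "norm (v x) \<le> real CARD('n) / (L * R)" if "x \<in> X" for x
  proof -
    have "\<bar>v x $ j\<bar> \<le> 1 / (L * R)" for j
      using less_imp_le[OF X_J[OF that, of j]] pos frac_ge_0[of "R * x $ j"]
      by (cases "j \<in> I") (simp_all add: v_def field_simps)
    then show ?thesis using norm_le_CARD_mult[of "v x" "1 / (L * R)"] by simp
  qed
  have v_I: "v x $ l = 0" if "l \<in> I" for x l using that by (simp add: v_def)
  have nonneg: "0 \<le> real CARD('n) / (L * R)" using pos by simp
  obtain G where G: "shear_field I G" "Ck_norm_le k (M * (real CARD('n) / (L * R)) / r ^ k) G"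
    "\<forall>x\<in>X. G x = v x"
    by (rule shear_interpolation[where v = v, OF bump X r nonneg norm_v v_I])
  have "R * (x + G x) $ j \<in> \<int>" if x: "x \<in> X" for x j
  proof (cases "j \<in> I")
    case True
    then show ?thesis using G(3) X_I[OF x] x by (simp add: v_def)
  next
    case False
    then have "R * (x + G x) $ j = R * x $ j - frac (R * x $ j)"
      using G(3) x pos by (simp add: v_def right_diff_distrib)
    then show ?thesis by (simp add: frac_def)
  qed
  then show ?thesis using that G(1,2) by (simp add: scaled_lattice_def)
qed

lemma abs_sin_diff_ge:
  fixes a b :: real
  assumes "a \<in> {0..1}" "b \<in> {0..1}"
  shows "\<bar>a - b\<bar> / 2 \<le> \<bar>sin a - sin b\<bar>"
proof -
  have increasing: "(y - x) / 2 \<le> sin y - sin x" if "0 \<le> x" "x \<le> y" "y \<le> 1" for x y :: real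
  proof (cases "x = y")
    case False
    then have "x < y" using that by simp
    then obtain z where z: "x < z" "z < y" "sin y - sin x = (y - x) * cos z"
      using MVT2[of x y sin cos] by (auto intro: DERIV_sin)
    have "cos (pi / 3) \<le> cos z" using z that pi_gt3 by (intro cos_monotone_0_pi_le) auto
    then have "1 / 2 \<le> cos z" by (simp add: cos_60)
    then show ?thesis using z(3) \<open>x < y\<close> mult_left_mono[of "1 / 2" "cos z" "y - x"] by simp
  qed simp
  show ?thesis
    using increasing[of a b] increasing[of b a] assms by (cases "a \<le> b") (auto simp: abs_if)
qed

lemma abs_scaled_sin_diff_ge:
  fixes u v :: real
  assumes "u \<in> {0..1}" "v \<in> {0..1}" "0 \<le> c" "2 \<le> c * \<bar>u - v\<bar>"
  shows "1 \<le> \<bar>c * sin u - c * sin v\<bar>"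
proof -
  have "1 \<le> c * (\<bar>u - v\<bar> / 2)" using assms(4) by simp
  also have "\<dots> \<le> c * \<bar>sin u - sin v\<bar>"
    by (rule mult_left_mono[OF abs_sin_diff_ge[OF assms(1,2)] assms(3)])
  also have "\<dots> = \<bar>c * sin u - c * sin v\<bar>"
    using assms(3) by (simp add: abs_mult flip: right_diff_distrib)
  finally show ?thesis .
qed

definition oscillating_shear ::
  "'n::finite set \<Rightarrow> real^'n \<Rightarrow> ('n \<Rightarrow> real) \<Rightarrow> ('n \<Rightarrow> 'n \<Rightarrow> real) \<Rightarrow> real^'n \<Rightarrow> real^'n" where
  "oscillating_shear I c \<tau> a x =
     (\<chi> j. if j \<in> I then 0 else \<tau> j + (\<Sum>l\<in>I. a j l * sin (x $ l - c $ l)))"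

lemma shear_field_oscillating_shear: "shear_field I (oscillating_shear I c \<tau> a)"
  by (auto simp: shear_field_def oscillating_shear_def fun_eq_iff intro!: sum.cong)

lemma Ck_norm_le_oscillating_shear:
  fixes c :: "real^'n::finite"
  assumes \<tau>: "\<And>j. j \<notin> I \<Longrightarrow> \<bar>\<tau> j\<bar> \<le> A" and a: "\<And>j l. j \<notin> I \<Longrightarrow> l \<in> I \<Longrightarrow> \<bar>a j l\<bar> \<le> \<alpha>"
    and nonneg: "0 \<le> A" "0 \<le> \<alpha>"
  shows "Ck_norm_le k (real CARD('n) * A + real CARD('n) ^ 2 * \<alpha>) (oscillating_shear I c \<tau> a)"
proof -
  define v0 :: "real^'n" where "v0 = (\<chi> j. if j \<in> I then 0 else \<tau> j)"
  define v :: "'n \<Rightarrow> real^'n" where "v l = (\<chi> j. if j \<in> I then 0 else a j l)" for l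
  have eq: "oscillating_shear I c \<tau> a = (\<lambda>x. v0 + (\<Sum>l\<in>I. sin (x $ l - c $ l) *\<^sub>R v l))"
    by (simp add: oscillating_shear_def v0_def v_def fun_eq_iff vec_eq_iff mult.commute)
  have Ck_sum: "Ck_norm_le k (norm v0 + (\<Sum>l\<in>I. norm (v l)))
      (\<lambda>x. v0 + (\<Sum>l\<in>I. sin (x $ l - c $ l) *\<^sub>R v l))"
    by (intro Ck_norm_le_add Ck_norm_le_const Ck_norm_le_sum Ck_norm_le_sin) auto
  have "norm v0 \<le> real CARD('n) * A"
    using \<tau> nonneg by (intro norm_le_CARD_mult) (simp add: v0_def)
  moreover have "(\<Sum>l\<in>I. norm (v l)) \<le> real CARD('n) ^ 2 * \<alpha>"
  proof -
    have "(\<Sum>l\<in>I. norm (v l)) \<le> (\<Sum>l\<in>I. real CARD('n) * \<alpha>)"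
      using a nonneg by (intro sum_mono norm_le_CARD_mult) (simp add: v_def)
    also have "\<dots> \<le> real CARD('n) * (real CARD('n) * \<alpha>)"
      using nonneg by (simp add: mult_right_mono card_mono)
    finally show ?thesis by (simp add: power2_eq_square)
  qed
  ultimately show ?thesis
    unfolding eq by (intro Ck_norm_le_mono[OF Ck_sum] add_mono)
qed

lemma exists_shear_near_lattice:
  fixes p :: "'z \<Rightarrow> 'y \<Rightarrow> real^'n::finite" and c :: "real^'n" and R \<alpha> :: real
  assumes fin: "finite Z" "finite Y" and pos: "L > 0" "R > 0" "\<alpha> > 0"
    and box: "\<And>z y l. z \<in> Z \<Longrightarrow> y \<in> Y \<Longrightarrow> l \<in> I \<Longrightarrow> p z y $ l - c $ l \<in> {0..1}"
    and sep: "\<And>z y y'. z \<in> Z \<Longrightarrow> y \<in> Y \<Longrightarrow> y' \<in> Y \<Longrightarrow> y \<noteq> y' \<Longrightarrow>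
      \<exists>l\<in>I. 2 \<le> \<alpha> * (R * \<bar>p z y $ l - p z y' $ l\<bar>)"
    and LY: "2 * 9 ^ card (- I) * real (card Y) \<le> real L ^ card (- I)"
  obtains G where "shear_field I G"
    "Ck_norm_le k (real CARD('n) / R + real CARD('n) ^ 2 * \<alpha>) G"
    "real (card Z) * real (card Y) / (2 * real L ^ card (- I)) \<le>
      real (card {z \<in> Z. \<exists>y\<in>Y. \<forall>j\<in>- I. frac (R * (p z y + G (p z y)) $ j) < 1 / real L})"
proof -
  define s where "s z y l = R * \<alpha> * sin (p z y $ l - c $ l)" for z y l
  have slopes: "\<exists>l\<in>I. \<bar>s z y l - s z y' l\<bar> \<ge> 1" if zy: "z \<in> Z" "y \<in> Y" "y' \<in> Y" "y \<noteq> y'" for z y y'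
  proof -
    obtain l where l: "l \<in> I" "2 \<le> \<alpha> * (R * \<bar>p z y $ l - p z y' $ l\<bar>)" using sep[OF zy] by blast
    then have "1 \<le> \<bar>s z y l - s z y' l\<bar>"
      unfolding s_def using zy pos
      by (intro abs_scaled_sin_diff_ge box) (simp_all add: mult_ac)
    then show ?thesis using l(1) by blast
  qed
  obtain \<tau> a where \<tau>: "\<forall>j\<in>- I. 0 \<le> \<tau> j \<and> \<tau> j \<le> 1"
    and a: "\<forall>j\<in>- I. \<forall>l\<in>I. 0 \<le> a j l \<and> a j l \<le> 1"
    and many: "real (card Z) * real (card Y) / (2 * real L ^ card (- I)) \<le> real (card {z \<in> Z. \<exists>y\<in>Y.
        \<forall>j\<in>- I. frac (R * p z y $ j + (\<Sum>l\<in>I. a j l * s z y l) + \<tau> j) < 1 / real L})"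
    by (rule exists_shear_with_many_good_cells[OF fin finite finite pos(1) slopes LY,
          where F = "\<lambda>z y j. R * p z y $ j"])
  define G where "G = oscillating_shear I c (\<lambda>j. \<tau> j / R) (\<lambda>j l. \<alpha> * a j l)"
  have "Ck_norm_le k (real CARD('n) * (1 / R) + real CARD('n) ^ 2 * \<alpha>) G"
    unfolding G_def using \<tau> a pos
    by (intro Ck_norm_le_oscillating_shear) (simp_all add: divide_right_mono abs_mult mult_left_le)
  moreover have "R * (p z y + G (p z y)) $ j = R * p z y $ j + (\<Sum>l\<in>I. a j l * s z y l) + \<tau> j"
    if "j \<in> - I" for z y j
    using that pos
    by (simp add: G_def oscillating_shear_def s_def distrib_left sum_distrib_left mult_ac)
  ultimately show ?thesis
    using that[of G] many shear_field_oscillating_shear[of I] by (simp add: G_def)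
qed

text \<open>The factor 2 separates neighbouring cells by more than their width, so that the bumps over
candidates in different cells have disjoint supports.\<close>

definition cell_candidate ::
  "real \<Rightarrow> real^'n::finite \<Rightarrow> nat \<Rightarrow> nat \<Rightarrow> ('n \<Rightarrow> nat) \<Rightarrow> ('n \<Rightarrow> nat) \<Rightarrow> real^'n" where
  "cell_candidate R c N w z y
      = (\<chi> l. of_int (\<lceil>R * c $ l\<rceil> + int N * (2 * int w * int (z l) + int (y l))) / R)"

lemma cell_candidate_nth:
  "R > 0 \<Longrightarrow> R * cell_candidate R c N w z y $ l
    = of_int (\<lceil>R * c $ l\<rceil> + int N * (2 * int w * int (z l) + int (y l)))"
  by (simp add: cell_candidate_def)

lemma cell_candidate_mem_cube:
  assumes R: "R > 0" and fits: "1 + 2 * real N * real w * real T \<le> R * \<rho>"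
    and zy: "z l < T" "y l < w"
  shows "cell_candidate R c N w z y $ l - c $ l \<in> {0..\<rho>}"
proof -
  let ?Q = "cell_candidate R c N w z y $ l"
  have "2 * w * z l + y l \<le> 2 * w * (z l + 1)" using zy by simp
  also have "\<dots> \<le> 2 * w * T" using zy by (intro mult_le_mono2) simp
  finally have "N * (2 * w * z l + y l) \<le> N * (2 * w * T)" by (rule mult_le_mono2)
  then have "real (N * (2 * w * z l + y l)) \<le> real (N * (2 * w * T))" by (rule of_nat_mono)
  then have "R * ?Q \<le> R * c $ l + 1 + 2 * real N * real w * real T"
    unfolding cell_candidate_nth[OF R] using of_int_ceiling_le_add_one[of "R * c $ l"]
    by (simp add: algebra_simps)
  then have "R * (?Q - c $ l) \<le> R * \<rho>" using fits by (simp add: algebra_simps)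
  moreover have "R * c $ l \<le> R * ?Q"
    unfolding cell_candidate_nth[OF R] using le_of_int_ceiling[of "R * c $ l"]
    by (simp add: add_increasing2)
  ultimately show ?thesis using R by simp
qed

lemma cell_candidate_diff_nth:
  assumes R: "R > 0"
  shows "R * \<bar>cell_candidate R c N w z y $ l - cell_candidate R c N w z' y' $ l\<bar>
    = real N * of_int \<bar>2 * int w * (int (z l) - int (z' l)) + (int (y l) - int (y' l))\<bar>"
proof -
  have "R * \<bar>cell_candidate R c N w z y $ l - cell_candidate R c N w z' y' $ l\<bar>
      = \<bar>R * cell_candidate R c N w z y $ l - R * cell_candidate R c N w z' y' $ l\<bar>"
    using R by (simp add: abs_mult flip: right_diff_distrib)
  also have "\<dots>
      = \<bar>real N * of_int (2 * int w * (int (z l) - int (z' l)) + (int (y l) - int (y' l)))\<bar>"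
    unfolding cell_candidate_nth[OF R] by (simp add: algebra_simps)
  finally show ?thesis by (simp add: abs_mult)
qed

lemma PiE_neqE:
  assumes "f \<in> PiE I A" "g \<in> PiE I B" "f \<noteq> g"
  obtains l where "l \<in> I" "f l \<noteq> g l"
  using assms PiE_ext by (metis PiE_arb ext)

lemma cell_candidate_separated_within_cell:
  assumes "R > 0" "y \<in> PiE I A" "y' \<in> PiE I A" "y \<noteq> y'"
  shows "\<exists>l\<in>I. real N \<le> R * \<bar>cell_candidate R c N w z y $ l - cell_candidate R c N w z y' $ l\<bar>"
proof -
  obtain l where l: "l \<in> I" "y l \<noteq> y' l" using PiE_neqE[OF assms(2-4)] .
  then have "1 \<le> real_of_int \<bar>int (y l) - int (y' l)\<bar>" by linarith
  then have "real N * 1 \<le> real N * real_of_int \<bar>int (y l) - int (y' l)\<bar>"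
    by (intro mult_left_mono) simp_all
  then show ?thesis
    using l(1) by (intro bexI[of _ l]) (simp_all add: cell_candidate_diff_nth[OF assms(1)])
qed

lemma cell_candidate_separated_between_cells:
  assumes "R > 0" "N > 0" and z: "z \<in> PiE I A" "z' \<in> PiE I A" "z \<noteq> z'"
    and y: "y \<in> I \<rightarrow>\<^sub>E {..<w}" "y' \<in> I \<rightarrow>\<^sub>E {..<w}"
  shows "\<exists>l\<in>I. real N * real w
    < R * \<bar>cell_candidate R c N w z y $ l - cell_candidate R c N w z' y' $ l\<bar>"
proof -
  obtain l where l: "l \<in> I" "z l \<noteq> z' l" using PiE_neqE[OF z] .
  define d where "d = int (z l) - int (z' l)"
  have "1 \<le> \<bar>d\<bar>" using l(2) by (simp add: d_def)
  then have "2 * int w * 1 \<le> 2 * int w * \<bar>d\<bar>" by (intro mult_left_mono) auto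
  also have "\<dots> = \<bar>2 * int w * d\<bar>" by (simp add: abs_mult)
  finally have "int w < \<bar>2 * int w * d + (int (y l) - int (y' l))\<bar>"
    using PiE_mem[OF y(1) l(1)] PiE_mem[OF y(2) l(1)] by simp
  then have "real w < real_of_int \<bar>2 * int w * d + (int (y l) - int (y' l))\<bar>" by linarith
  then show ?thesis
    using l(1) assms(2)
    by (intro bexI[of _ l]) (simp_all add: cell_candidate_diff_nth[OF assms(1)] d_def)
qed

lemma card_le_card_image_Int_scaled_lattice:
  fixes \<Sigma> :: "(real^'n::finite) set"
  assumes "compact \<Sigma>" "continuous_on \<Sigma> \<Phi>" "R > 0"
    and "inj_on (\<Phi> \<circ> p) Z" "\<And>z. z \<in> Z \<Longrightarrow> p z \<in> \<Sigma>" "\<And>z. z \<in> Z \<Longrightarrow> \<Phi> (p z) \<in> scaled_lattice R"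
  shows "card Z \<le> card (\<Phi> ` \<Sigma> \<inter> scaled_lattice R)"
proof (rule card_inj_on_le[OF assms(4)])
  show "(\<Phi> \<circ> p) ` Z \<subseteq> \<Phi> ` \<Sigma> \<inter> scaled_lattice R" using assms(5,6) by auto
  have "bounded (\<Phi> ` \<Sigma>)"
    by (rule compact_imp_bounded[OF compact_continuous_image[OF assms(2,1)]])
  then show "finite (\<Phi> ` \<Sigma> \<inter> scaled_lattice R)"
    using assms(3) by (rule finite_bounded_Int_scaled_lattice)
qed

lemma inj_on_shear_of_separated:
  assumes G: "shear_field I G" and r: "0 \<le> r"
    and sep: "\<And>z z'. z \<in> Z \<Longrightarrow> z' \<in> Z \<Longrightarrow> z \<noteq> z' \<Longrightarrow> \<exists>l\<in>I. r < \<bar>q z $ l - q z' $ l\<bar>"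
  shows "inj_on ((\<lambda>x. x + G x) \<circ> q) Z"
proof (rule inj_onI, rule ccontr)
  fix z z' assume z: "z \<in> Z" "z' \<in> Z" "((\<lambda>x. x + G x) \<circ> q) z = ((\<lambda>x. x + G x) \<circ> q) z'" "z \<noteq> z'"
  then obtain l where l: "l \<in> I" "r < \<bar>q z $ l - q z' $ l\<bar>" using sep by blast
  have "q z $ l = q z' $ l"
    using arg_cong[OF z(3), of "\<lambda>x. x $ l"] shear_field_nth[OF G l(1)] by simp
  then show False using l(2) r by simp
qed

lemma shear_with_lattice_points_near:
  fixes \<Sigma> :: "(real^'n::finite) set" and q :: "'z \<Rightarrow> real^'n"
  assumes bump: "\<And>v. Ck_norm_le k (M * norm v) (\<lambda>x. cube_bump k I x *\<^sub>R (v :: real^'n))"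
    and \<Sigma>: "compact \<Sigma>" and Z: "finite Z" and r: "0 < r" "r \<le> 1" and pos: "R > 0" "L > 0"
    and F: "shear_field I F" "Ck_norm_le k B F"
    and q: "\<And>z. z \<in> Z \<Longrightarrow> q z \<in> \<Sigma>" "\<And>z l. z \<in> Z \<Longrightarrow> l \<in> I \<Longrightarrow> R * q z $ l \<in> \<int>"
    and near: "\<And>z j. z \<in> Z \<Longrightarrow> j \<notin> I \<Longrightarrow> frac (R * (q z + F (q z)) $ j) < 1 / L"
    and sep: "\<And>z z'. z \<in> Z \<Longrightarrow> z' \<in> Z \<Longrightarrow> z \<noteq> z' \<Longrightarrow> \<exists>l\<in>I. 2 * r < \<bar>q z $ l - q z' $ l\<bar>"
  obtains G where "shear_field I G" "Ck_norm_le k (B + M * (real CARD('n) / (L * R)) / r ^ k) G"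
    "card Z \<le> card ((\<lambda>x. x + G x) ` \<Sigma> \<inter> scaled_lattice R)"
proof -
  note F_nth = shear_field_nth[OF F(1)]
  define X where "X = (\<lambda>z. q z + F (q z)) ` Z"
  have X_sep: "\<exists>l\<in>I. 2 * r < \<bar>x $ l - y $ l\<bar>" if xy: "x \<in> X" "y \<in> X" "x \<noteq> y" for x y
  proof -
    obtain z z' where z: "z \<in> Z" "x = q z + F (q z)" "z' \<in> Z" "y = q z' + F (q z')"
      using xy(1,2) by (auto simp: X_def)
    then obtain l where "l \<in> I" "2 * r < \<bar>q z $ l - q z' $ l\<bar>" using sep[of z z'] xy(3) by blast
    then show ?thesis using z F_nth by (intro bexI[of _ l]) simp_all
  qed
  have X_I: "R * x $ l \<in> \<int>" if "x \<in> X" "l \<in> I" for x l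
    using that q(2) F_nth by (auto simp: X_def)
  have X_J: "frac (R * x $ j) < 1 / L" if "x \<in> X" "j \<notin> I" for x j
    using that near by (auto simp: X_def)
  have "finite X" using Z by (simp add: X_def)
  then obtain H where H: "shear_field I H" "Ck_norm_le k (M * (real CARD('n) / (L * R)) / r ^ k) H"
    and lattice: "\<forall>x\<in>X. x + H x \<in> scaled_lattice R"
    by (rule shear_into_lattice[OF bump _ X_sep r pos X_I X_J])
  define G where "G x = F x + H x" for x
  have G: "shear_field I G" "Ck_norm_le k (B + M * (real CARD('n) / (L * R)) / r ^ k) G"
    unfolding G_def by (intro shear_field_add Ck_norm_le_add F H)+
  have in_lattice: "q z + G (q z) \<in> scaled_lattice R" if "z \<in> Z" for z
  proof -
    have "H (q z + F (q z)) = H (q z)" by (rule shear_field_cong[OF H(1)]) (simp add: F_nth)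
    moreover have "q z + F (q z) + H (q z + F (q z)) \<in> scaled_lattice R"
      using lattice that unfolding X_def by blast
    ultimately show ?thesis by (simp add: G_def add.assoc)
  qed
  have inj: "inj_on ((\<lambda>x. x + G x) \<circ> q) Z"
    using r(1) by (intro inj_on_shear_of_separated[OF G(1) _ sep]) simp_all
  have cont: "continuous_on \<Sigma> (\<lambda>x. x + G x)"
    by (rule continuous_on_add[OF continuous_on_id
          continuous_on_subset[OF Ck_norm_le_imp_continuous_on[OF G(2)] subset_UNIV]])
  have "card Z \<le> card ((\<lambda>x. x + G x) ` \<Sigma> \<inter> scaled_lattice R)"
    by (rule card_le_card_image_Int_scaled_lattice[OF \<Sigma> cont pos(1) inj q(1) in_lattice])
  then show ?thesis using that G by simp
qed

lemma exists_point_over_candidate: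
  fixes \<Sigma> :: "(real^'n::finite) set"
  assumes \<Sigma>: "projects_onto_cube I c \<rho> \<Sigma>" and \<rho>: "\<rho> \<le> 1" and R: "R > 0"
    and fits: "1 + 2 * real N * real w * real T \<le> R * \<rho>"
    and z: "z \<in> I \<rightarrow>\<^sub>E {..<T}" and y: "y \<in> I \<rightarrow>\<^sub>E {..<w}"
  shows "\<exists>p\<in>\<Sigma>. \<forall>l\<in>I. p $ l = cell_candidate R c N w z y $ l \<and> p $ l - c $ l \<in> {0..1}"
proof -
  have cube: "cell_candidate R c N w z y $ l - c $ l \<in> {0..\<rho>}" if "l \<in> I" for l
    using z y that by (intro cell_candidate_mem_cube[OF R fits]) (auto simp: PiE_iff)
  then have "\<forall>l\<in>I. \<bar>cell_candidate R c N w z y $ l - c $ l\<bar> \<le> \<rho>" by simp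
  then obtain p where "p \<in> \<Sigma>" "\<forall>l\<in>I. p $ l = cell_candidate R c N w z y $ l"
    using \<Sigma> unfolding projects_onto_cube_def by blast
  then show ?thesis using cube \<rho> by (intro bexI[of _ p]) force+
qed

lemma exists_separated_points_over_lattice:
  fixes \<Sigma> :: "(real^'n::finite) set"
  assumes \<Sigma>: "projects_onto_cube I c \<rho> \<Sigma>" and \<rho>: "\<rho> \<le> 1" and pos: "R > 0" "N > 0"
    and fits: "1 + 2 * real N * real w * real T \<le> R * \<rho>"
  obtains p where
    "\<forall>z\<in>I \<rightarrow>\<^sub>E {..<T}. \<forall>y\<in>I \<rightarrow>\<^sub>E {..<w}. p z y \<in> \<Sigma> \<and>
       (\<forall>l\<in>I. R * p z y $ l \<in> \<int> \<and> p z y $ l - c $ l \<in> {0..1})"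
    "\<forall>z\<in>I \<rightarrow>\<^sub>E {..<T}. \<forall>y\<in>I \<rightarrow>\<^sub>E {..<w}. \<forall>y'\<in>I \<rightarrow>\<^sub>E {..<w}. y \<noteq> y' \<longrightarrow>
       (\<exists>l\<in>I. real N \<le> R * \<bar>p z y $ l - p z y' $ l\<bar>)"
    "\<forall>z\<in>I \<rightarrow>\<^sub>E {..<T}. \<forall>z'\<in>I \<rightarrow>\<^sub>E {..<T}. \<forall>y\<in>I \<rightarrow>\<^sub>E {..<w}. \<forall>y'\<in>I \<rightarrow>\<^sub>E {..<w}. z \<noteq> z' \<longrightarrow>
       (\<exists>l\<in>I. real N * real w < R * \<bar>p z y $ l - p z' y' $ l\<bar>)"
proof -
  have "\<forall>z\<in>I \<rightarrow>\<^sub>E {..<T}. \<forall>y\<in>I \<rightarrow>\<^sub>E {..<w}. \<exists>p. p \<in> \<Sigma> \<and>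
      (\<forall>l\<in>I. p $ l = cell_candidate R c N w z y $ l \<and> p $ l - c $ l \<in> {0..1})"
    using exists_point_over_candidate[OF \<Sigma> \<rho> pos(1) fits] by blast
  then obtain p where p: "\<forall>z\<in>I \<rightarrow>\<^sub>E {..<T}. \<forall>y\<in>I \<rightarrow>\<^sub>E {..<w}. p z y \<in> \<Sigma> \<and>
      (\<forall>l\<in>I. p z y $ l = cell_candidate R c N w z y $ l \<and> p z y $ l - c $ l \<in> {0..1})"
    by metis
  show ?thesis
  proof (rule that[of p]; intro ballI impI)
    fix z y assume "z \<in> I \<rightarrow>\<^sub>E {..<T}" "y \<in> I \<rightarrow>\<^sub>E {..<w}"
    then have "p z y \<in> \<Sigma>" and nth: "\<And>l. l \<in> I \<Longrightarrow> p z y $ l = cell_candidate R c N w z y $ l"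
      and "\<And>l. l \<in> I \<Longrightarrow> p z y $ l - c $ l \<in> {0..1}"
      using p by blast+
    moreover have "R * p z y $ l \<in> \<int>" if "l \<in> I" for l
      unfolding nth[OF that] cell_candidate_nth[OF pos(1)] by simp
    ultimately show "p z y \<in> \<Sigma> \<and> (\<forall>l\<in>I. R * p z y $ l \<in> \<int> \<and> p z y $ l - c $ l \<in> {0..1})"
      by blast
  next
    fix z y y' assume zy: "z \<in> I \<rightarrow>\<^sub>E {..<T}" "y \<in> I \<rightarrow>\<^sub>E {..<w}" "y' \<in> I \<rightarrow>\<^sub>E {..<w}" "y \<noteq> y'"
    from cell_candidate_separated_within_cell[OF pos(1) zy(2-4), of N c w z]
    show "\<exists>l\<in>I. real N \<le> R * \<bar>p z y $ l - p z y' $ l\<bar>" using p zy(1-3) by simp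
  next
    fix z z' y y' assume zy: "z \<in> I \<rightarrow>\<^sub>E {..<T}" "z' \<in> I \<rightarrow>\<^sub>E {..<T}"
      "y \<in> I \<rightarrow>\<^sub>E {..<w}" "y' \<in> I \<rightarrow>\<^sub>E {..<w}" "z \<noteq> z'"
    from cell_candidate_separated_between_cells[OF pos zy(1,2,5,3,4), of c]
    show "\<exists>l\<in>I. real N * real w < R * \<bar>p z y $ l - p z' y' $ l\<bar>" using p zy(1-4) by simp
  qed
qed

lemma exists_shear_with_near_lattice_points:
  fixes \<Sigma> :: "(real^'n::finite) set" and N w T L :: nat and R \<rho> \<alpha> :: real
  assumes \<Sigma>: "projects_onto_cube I c \<rho> \<Sigma>" and \<rho>: "\<rho> \<le> 1"
    and pos: "N > 0" "L > 0" "R > 0" "\<alpha> > 0" and \<alpha>N: "\<alpha> * real N \<ge> 2"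
    and fits: "1 + 2 * real N * real w * real T \<le> R * \<rho>"
    and Lw: "2 * 9 ^ card (- I) * real w ^ card I \<le> real L ^ card (- I)"
  obtains F Z and q :: "('n \<Rightarrow> nat) \<Rightarrow> real^'n" where
    "shear_field I F" "Ck_norm_le k (real CARD('n) / R + real CARD('n) ^ 2 * \<alpha>) F" "finite Z"
    "\<forall>z\<in>Z. q z \<in> \<Sigma> \<and> (\<forall>l\<in>I. R * q z $ l \<in> \<int>) \<and>
       (\<forall>j\<in>- I. frac (R * (q z + F (q z)) $ j) < 1 / real L)"
    "\<forall>z\<in>Z. \<forall>z'\<in>Z. z \<noteq> z' \<longrightarrow> (\<exists>l\<in>I. real N * real w < R * \<bar>q z $ l - q z' $ l\<bar>)"
    "real T ^ card I * real w ^ card I / (2 * real L ^ card (- I)) \<le> real (card Z)"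
proof -
  define A where "A = (I \<rightarrow>\<^sub>E {..<T})"
  define Y where "Y = (I \<rightarrow>\<^sub>E {..<w})"
  have fin: "finite A" "finite Y" by (auto simp: A_def Y_def finite_PiE)
  have cards: "card A = T ^ card I" "card Y = w ^ card I" by (auto simp: A_def Y_def card_PiE)
  obtain p where p: "\<forall>z\<in>A. \<forall>y\<in>Y. p z y \<in> \<Sigma> \<and> (\<forall>l\<in>I. R * p z y $ l \<in> \<int> \<and> p z y $ l - c $ l \<in> {0..1})"
    and within: "\<forall>z\<in>A. \<forall>y\<in>Y. \<forall>y'\<in>Y. y \<noteq> y' \<longrightarrow> (\<exists>l\<in>I. real N \<le> R * \<bar>p z y $ l - p z y' $ l\<bar>)"
    and between: "\<forall>z\<in>A. \<forall>z'\<in>A. \<forall>y\<in>Y. \<forall>y'\<in>Y. z \<noteq> z' \<longrightarrow>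
      (\<exists>l\<in>I. real N * real w < R * \<bar>p z y $ l - p z' y' $ l\<bar>)"
    unfolding A_def Y_def by (rule exists_separated_points_over_lattice[OF \<Sigma> \<rho> pos(3,1) fits])
  have box: "p z y $ l - c $ l \<in> {0..1}" if "z \<in> A" "y \<in> Y" "l \<in> I" for z y l
    using p that by blast
  have sep: "\<exists>l\<in>I. 2 \<le> \<alpha> * (R * \<bar>p z y $ l - p z y' $ l\<bar>)"
    if zy: "z \<in> A" "y \<in> Y" "y' \<in> Y" "y \<noteq> y'" for z y y'
  proof -
    obtain l where l: "l \<in> I" "real N \<le> R * \<bar>p z y $ l - p z y' $ l\<bar>" using within zy by blast
    then have "\<alpha> * real N \<le> \<alpha> * (R * \<bar>p z y $ l - p z y' $ l\<bar>)" using pos by simp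
    then show ?thesis using l(1) \<alpha>N by (intro bexI[of _ l]) simp_all
  qed
  have LY: "2 * 9 ^ card (- I) * real (card Y) \<le> real L ^ card (- I)" using Lw by (simp add: cards)
  obtain F where F: "shear_field I F" "Ck_norm_le k (real CARD('n) / R + real CARD('n) ^ 2 * \<alpha>) F"
    and many: "real (card A) * real (card Y) / (2 * real L ^ card (- I)) \<le>
      real (card {z \<in> A. \<exists>y\<in>Y. \<forall>j\<in>- I. frac (R * (p z y + F (p z y)) $ j) < 1 / real L})"
    by (rule exists_shear_near_lattice[OF fin pos(2,3,4) box sep LY])
  define Z where "Z = {z \<in> A. \<exists>y\<in>Y. \<forall>j\<in>- I. frac (R * (p z y + F (p z y)) $ j) < 1 / real L}"
  have ZA: "Z \<subseteq> A" by (auto simp: Z_def)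
  have "\<forall>z\<in>Z. \<exists>y. y \<in> Y \<and> (\<forall>j\<in>- I. frac (R * (p z y + F (p z y)) $ j) < 1 / real L)"
    by (auto simp: Z_def)
  then obtain y where y:
    "\<forall>z\<in>Z. y z \<in> Y \<and> (\<forall>j\<in>- I. frac (R * (p z (y z) + F (p z (y z))) $ j) < 1 / real L)"
    by (rule bchoice[THEN exE])
  show ?thesis
  proof (rule that[OF F, of Z "\<lambda>z. p z (y z)"])
    show "finite Z" by (rule finite_subset[OF ZA fin(1)])
    show "\<forall>z\<in>Z. p z (y z) \<in> \<Sigma> \<and> (\<forall>l\<in>I. R * p z (y z) $ l \<in> \<int>) \<and>
        (\<forall>j\<in>- I. frac (R * (p z (y z) + F (p z (y z))) $ j) < 1 / real L)"
      using p y ZA by blast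
    show "\<forall>z\<in>Z. \<forall>z'\<in>Z. z \<noteq> z' \<longrightarrow> (\<exists>l\<in>I. real N * real w < R * \<bar>p z (y z) $ l - p z' (y z') $ l\<bar>)"
      using between y ZA by blast
    show "real T ^ card I * real w ^ card I / (2 * real L ^ card (- I)) \<le> real (card Z)"
      using many by (simp add: cards Z_def)
  qed
qed

lemma many_lattice_points_at_scale:
  fixes \<Sigma> :: "(real^'n::finite) set" and N w T L :: nat and R \<rho> \<alpha> M :: real
  assumes bump: "\<And>v. Ck_norm_le k (M * norm v) (\<lambda>x. cube_bump k I x *\<^sub>R (v :: real^'n))"
    and \<Sigma>: "compact \<Sigma>" "projects_onto_cube I c \<rho> \<Sigma>" and \<rho>: "\<rho> \<le> 1"
    and pos: "N > 0" "w > 0" "T > 0" "L > 0" "R > 0" "\<alpha> > 0" and \<alpha>N: "\<alpha> * real N \<ge> 2"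
    and fits: "1 + 2 * real N * real w * real T \<le> R * \<rho>"
    and Lw: "2 * 9 ^ card (- I) * real w ^ card I \<le> real L ^ card (- I)"
  obtains G where "shear_field I G"
    "Ck_norm_le k (real CARD('n) / R + real CARD('n) ^ 2 * \<alpha> +
       M * (real CARD('n) / (real L * R)) / (real N * real w / (2 * R)) ^ k) G"
    "real T ^ card I * real w ^ card I / (2 * real L ^ card (- I))
      \<le> real (card ((\<lambda>x. x + G x) ` \<Sigma> \<inter> scaled_lattice R))"
proof -
  obtain F Z and q :: "('n \<Rightarrow> nat) \<Rightarrow> real^'n" where F: "shear_field I F"
      "Ck_norm_le k (real CARD('n) / R + real CARD('n) ^ 2 * \<alpha>) F"
    and Z: "finite Z"
      "real T ^ card I * real w ^ card I / (2 * real L ^ card (- I)) \<le> real (card Z)"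
    and q: "\<forall>z\<in>Z. q z \<in> \<Sigma> \<and> (\<forall>l\<in>I. R * q z $ l \<in> \<int>)
        \<and> (\<forall>j\<in>- I. frac (R * (q z + F (q z)) $ j) < 1 / real L)"
    and sep: "\<forall>z\<in>Z. \<forall>z'\<in>Z. z \<noteq> z' \<longrightarrow> (\<exists>l\<in>I. real N * real w < R * \<bar>q z $ l - q z' $ l\<bar>)"
    by (rule exists_shear_with_near_lattice_points[OF \<Sigma>(2) \<rho> pos(1,4,5,6) \<alpha>N fits Lw])
  define r where "r = real N * real w / (2 * R)"
  have r0: "0 < r" using pos by (simp add: r_def)
  have "real N * real w * 1 \<le> real N * real w * real T" using pos by (intro mult_left_mono) auto
  moreover have "R * \<rho> \<le> R * 1" using \<rho> pos by (intro mult_left_mono) auto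
  moreover have "0 \<le> real N * real w" by simp
  ultimately have "real N * real w \<le> 2 * R" using fits pos by linarith
  then have r1: "r \<le> 1" using pos by (simp add: r_def)
  have q_sep: "\<exists>l\<in>I. 2 * r < \<bar>q z $ l - q z' $ l\<bar>" if "z \<in> Z" "z' \<in> Z" "z \<noteq> z'" for z z'
    using sep that pos(5) by (auto simp: r_def field_simps)
  have q_\<Sigma>: "q z \<in> \<Sigma>" "l \<in> I \<Longrightarrow> R * q z $ l \<in> \<int>"
    "j \<notin> I \<Longrightarrow> frac (R * (q z + F (q z)) $ j) < 1 / real L"
    if "z \<in> Z" for z l j
    using q that by simp_all
  have "0 < real L" using pos by simp
  then obtain G where G: "shear_field I G"
    "Ck_norm_le k (real CARD('n) / R + real CARD('n) ^ 2 * \<alpha> +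
       M * (real CARD('n) / (real L * R)) / r ^ k) G"
    "card Z \<le> card ((\<lambda>x. x + G x) ` \<Sigma> \<inter> scaled_lattice R)"
    by (rule shear_with_lattice_points_near[where q = q,
      OF bump \<Sigma>(1) Z(1) r0 r1 pos(5) _ F q_\<Sigma> q_sep])
  then show ?thesis using that Z(2) by (simp add: r_def)
qed

subsection \<open>Choice of the scales\<close>

text \<open>Candidates are \<open>N/R\<close> apart, a cell has \<open>w\<close> of them along each edge, the cube has \<open>T\<close> cells
along each edge, and the bumps have height \<open>1/(LR)\<close>. The last three conditions say that the cells fit into
the cube, that the second moment estimate applies, and that the bumps are small in \<open>C\<^sup>k\<close>.\<close>

definition admissible_scale ::
  "real \<Rightarrow> real \<Rightarrow> nat \<Rightarrow> nat \<Rightarrow> nat \<Rightarrow> nat \<Rightarrow> real \<Rightarrow> nat \<Rightarrow> nat \<Rightarrow> nat \<Rightarrow> bool" where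
  "admissible_scale \<rho> K N k m d R w T L \<longleftrightarrow> w > 0 \<and> T > 0 \<and> L > 0 \<and>
     1 + 2 * real N * real w * real T \<le> R * \<rho> \<and> 2 * 9 ^ d * real w ^ m \<le> real L ^ d \<and>
     K * R ^ (k - 1) \<le> real w ^ k * real L"

lemma exists_nat_near_root_multiple:
  fixes x :: real
  assumes "d \<ge> 1" "x \<ge> 1"
  obtains L :: nat where "x powr (1 / real d) \<le> real L" "2 * 9 ^ d * x \<le> real L ^ d"
    "real L ^ d \<le> 19 ^ d * x"
proof -
  define W where "W = x powr (1 / real d)"
  have W1: "W \<ge> 1" using assms by (simp add: W_def ge_one_powr_ge_zero)
  have W_d: "W ^ d = x" using assms by (simp add: W_def powr_powr flip: powr_realpow)
  define L where "L = nat \<lceil>18 * W\<rceil>"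
  have L: "18 * W \<le> real L" "real L \<le> 19 * W" using W1 unfolding L_def by linarith+
  have "2 * 9 ^ d * W ^ d \<le> 2 ^ d * 9 ^ d * W ^ d"
    using assms(1) W1 self_le_power[of "2::real" d] by (intro mult_right_mono) auto
  also have "\<dots> = (2 * 9 * W) ^ d" by (simp only: power_mult_distrib)
  also have "\<dots> \<le> real L ^ d" using L(1) W1 by (intro power_mono) auto
  finally have "2 * 9 ^ d * x \<le> real L ^ d" by (simp only: W_d)
  moreover have "real L ^ d \<le> (19 * W) ^ d" using L(2) by (intro power_mono) auto
  then have "real L ^ d \<le> 19 ^ d * x" by (simp add: power_mult_distrib W_d)
  ultimately show ?thesis using that[of L] L(1) W1 by (simp add: W_def)
qed

lemma exists_cell_size:
  fixes K R :: real and d k m :: nat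
  assumes "d \<ge> 1" "k \<ge> 1" and K: "K \<ge> 1" and R: "R \<ge> 1"
  obtains w L :: nat where "w > 0" "L > 0"
    "real w \<le> 2 * K * R powr ((real k - 1) * real d / (real m + real k * real d))"
    "K * R ^ (k - 1) \<le> real w ^ k * real L"
    "2 * 9 ^ d * real w ^ m \<le> real L ^ d" "real L ^ d \<le> 19 ^ d * real w ^ m"
proof -
  define D where "D = real m + real k * real d"
  define \<theta> where "\<theta> = (real k - 1) * real d / D"
  have d0: "real d > 0" and D0: "D > 0" using assms(1,2) by (simp_all add: D_def add_nonneg_pos)
  have "1 \<le> R powr \<theta>" using R assms(2) D0 by (simp add: \<theta>_def ge_one_powr_ge_zero)
  then have KR: "1 \<le> K * R powr \<theta>" using mult_mono[OF K, of 1 "R powr \<theta>"] K by simp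
  define w where "w = nat \<lceil>K * R powr \<theta>\<rceil>"
  have w: "K * R powr \<theta> \<le> real w" "real w \<le> 2 * (K * R powr \<theta>)" "real w \<ge> 1"
    using KR unfolding w_def by linarith+
  have "1 \<le> real w ^ m" using w(3) by simp
  then obtain L :: nat where "(real w ^ m) powr (1 / real d) \<le> real L"
    and L: "2 * 9 ^ d * real w ^ m \<le> real L ^ d" "real L ^ d \<le> 19 ^ d * real w ^ m"
    by (rule exists_nat_near_root_multiple[OF assms(1)])
  then have root: "real w powr (real m / real d) \<le> real L"
    using w(3) by (simp add: powr_powr flip: powr_realpow)
  have "K * R ^ (k - 1) \<le> K powr (D / real d) * R ^ (k - 1)"
  proof -
    have "1 * real d \<le> real k * real d" using assms(2) by (intro mult_right_mono) auto
    then have "real d \<le> D" unfolding D_def by linarith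
    then have "1 \<le> D / real d" using d0 by simp
    then have "K powr 1 \<le> K powr (D / real d)" using K by (intro powr_mono) auto
    then show ?thesis using K R by (intro mult_right_mono) auto
  qed
  also have "\<dots> = (K * R powr \<theta>) powr (D / real d)"
  proof -
    have "\<theta> * (D / real d) = real (k - 1)" using D0 d0 assms(2) by (simp add: \<theta>_def of_nat_diff)
    then show ?thesis using K R by (simp add: powr_mult powr_powr flip: powr_realpow)
  qed
  also have "\<dots> \<le> real w powr (D / real d)" using w(1) KR D0 by (intro powr_mono2) auto
  also have "\<dots> = real w ^ k * real w powr (real m / real d)"
  proof -
    have "D / real d = real k + real m / real d" using d0 by (simp add: D_def field_simps)
    then show ?thesis using w(3) by (simp add: powr_add powr_realpow)
  qed
  also have "\<dots> \<le> real w ^ k * real L" using root by (intro mult_left_mono) auto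
  finally have wL: "K * R ^ (k - 1) \<le> real w ^ k * real L" .
  have "real L > 0" using root w(3) by (intro less_le_trans[OF _ root]) simp
  then show ?thesis
    using that[of w L] w wL L by (simp add: \<theta>_def D_def mult.assoc)
qed

lemma exists_cell_count:
  fixes \<rho> K R \<sigma> :: real and N w :: nat
  assumes \<rho>: "0 < \<rho>" and N: "N > 0" and w: "w > 0" "real w \<le> 2 * K * R powr (1 - \<sigma>)"
    and R: "1 \<le> R" "2 \<le> R * \<rho>" "8 * real N * K \<le> \<rho> * R powr \<sigma>"
  obtains T :: nat where "T > 0" "1 + 2 * real N * real w * real T \<le> R * \<rho>"
    "\<rho> / (16 * real N * K) * R powr \<sigma> \<le> real T"
proof -
  define x where "x = (R * \<rho> - 1) / (2 * real N * real w)"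
  have "0 < 2 * K * R powr (1 - \<sigma>)" using w by simp
  then have K: "0 < K" using R(1) by (simp add: zero_less_mult_iff)
  have "R powr (1 - \<sigma>) * R powr \<sigma> = R" using R(1) by (simp flip: powr_add)
  then have product:
    "\<rho> * R powr \<sigma> * (2 * real N * (2 * K * R powr (1 - \<sigma>))) = 4 * real N * K * (R * \<rho>)"
    by (simp add: mult_ac)
  have "\<rho> * R powr \<sigma> * (2 * real N * real w) \<le> 4 * real N * K * (R * \<rho>)"
    unfolding product[symmetric] using w(2) \<rho> by (intro mult_left_mono) auto
  also have "\<dots> \<le> (R * \<rho> - 1) * (8 * real N * K)"
    using mult_left_mono[of "R * \<rho>" "2 * (R * \<rho> - 1)" "4 * real N * K"] R(2) K
    by (simp add: mult_ac)
  finally have "\<rho> * R powr \<sigma> * (2 * real N * real w) / (8 * real N * K) \<le> R * \<rho> - 1"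
    using N K by (subst pos_divide_le_eq) simp_all
  then have x_ge: "\<rho> / (8 * real N * K) * R powr \<sigma> \<le> x"
    unfolding x_def using N w(1) by (subst pos_le_divide_eq) simp_all
  moreover have "1 \<le> \<rho> / (8 * real N * K) * R powr \<sigma>" using R(3) N K by (simp add: field_simps)
  ultimately have x1: "1 \<le> x" by linarith
  define T where "T = nat \<lfloor>x\<rfloor>"
  have "1 \<le> \<lfloor>x\<rfloor>" "real T = of_int \<lfloor>x\<rfloor>" using x1 by (simp_all add: T_def)
  then have T: "T > 0" "real T \<le> x" "x \<le> 2 * real T" using floor_correct[of x] by linarith+
  show ?thesis
  proof (rule that[OF T(1)])
    have "real T * (2 * real N * real w) \<le> R * \<rho> - 1"
      using T(2) N w(1) unfolding x_def by (subst (asm) pos_le_divide_eq) simp_all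
    then show "1 + 2 * real N * real w * real T \<le> R * \<rho>" by (simp add: mult_ac)
    show "\<rho> / (16 * real N * K) * R powr \<sigma> \<le> real T" using x_ge T(3) by simp
  qed
qed

lemma exists_admissible_scales:
  fixes \<rho> K :: real and N d k m :: nat
  assumes dk: "d \<ge> 1" "k \<ge> 1" and \<rho>: "\<rho> > 0" and N: "N > 0" and K: "K \<ge> 1"
  obtains C c :: real where "C > 0" "c > 0"
    "\<forall>R\<ge>C. \<exists>w T L. admissible_scale \<rho> K N k m d R w T L \<and>
       c * R powr (real m * (real m + real d) / (real m + real k * real d))
         \<le> real T ^ m * real w ^ m / (2 * real L ^ d)"
proof -
  define \<sigma> where "\<sigma> = (real m + real d) / (real m + real k * real d)"
  have den: "0 < real m + real k * real d" using dk by (simp add: add_nonneg_pos)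
  then have \<sigma>0: "\<sigma> > 0" using dk by (simp add: \<sigma>_def add_nonneg_pos)
  have \<theta>: "(real k - 1) * real d / (real m + real k * real d) = 1 - \<sigma>"
    using den by (simp add: \<sigma>_def field_simps)
  define \<kappa> where "\<kappa> = \<rho> / (16 * real N * K)"
  have \<kappa>0: "\<kappa> > 0" using \<rho> N K by (simp add: \<kappa>_def)
  define C where "C = max (max 1 (2 / \<rho>)) ((8 * real N * K / \<rho>) powr (1 / \<sigma>))"
  define c where "c = \<kappa> ^ m / (2 * 19 ^ d)"
  have "\<exists>w T L. admissible_scale \<rho> K N k m d R w T L \<and>
      c * R powr (real m * \<sigma>) \<le> real T ^ m * real w ^ m / (2 * real L ^ d)" if "R \<ge> C" for R
  proof -
    have R: "1 \<le> R" "2 / \<rho> \<le> R" "(8 * real N * K / \<rho>) powr (1 / \<sigma>) \<le> R"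
      using that by (simp_all add: C_def)
    obtain w L :: nat where w: "w > 0" "real w \<le> 2 * K * R powr (1 - \<sigma>)" and L: "L > 0"
      and wL: "K * R ^ (k - 1) \<le> real w ^ k * real L"
      "2 * 9 ^ d * real w ^ m \<le> real L ^ d" "real L ^ d \<le> 19 ^ d * real w ^ m"
      by (rule exists_cell_size[OF dk K R(1), of m, unfolded \<theta>])
    have "((8 * real N * K / \<rho>) powr (1 / \<sigma>)) powr \<sigma> \<le> R powr \<sigma>"
      using R(3) \<sigma>0 by (intro powr_mono2) auto
    then have NK: "8 * real N * K \<le> \<rho> * R powr \<sigma>"
      using \<sigma>0 \<rho> N K by (simp add: powr_powr field_simps)
    have "2 \<le> R * \<rho>" using R(2) \<rho> by (simp add: field_simps)
    then obtain T :: nat where T: "T > 0" "1 + 2 * real N * real w * real T \<le> R * \<rho>"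
      "\<kappa> * R powr \<sigma> \<le> real T"
      unfolding \<kappa>_def by (rule exists_cell_count[OF \<rho> N w R(1) _ NK])
    have "c * R powr (real m * \<sigma>) = (\<kappa> * R powr \<sigma>) ^ m / (2 * 19 ^ d)"
      using R(1) by (simp add: c_def power_mult_distrib powr_powr mult.commute flip: powr_realpow)
    also have "\<dots> \<le> real T ^ m / (2 * 19 ^ d)"
      using T(3) \<kappa>0 by (intro divide_right_mono power_mono) auto
    also have "\<dots> = real T ^ m * real w ^ m / (2 * (19 ^ d * real w ^ m))" using w(1) by simp
    also have "\<dots> \<le> real T ^ m * real w ^ m / (2 * real L ^ d)"
      using wL(3) w(1) L by (intro divide_left_mono mult_left_mono mult_pos_pos) auto
    finally show ?thesis using w(1) L wL T(1,2) unfolding admissible_scale_def by blast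
  qed
  moreover have "C > 0" "c > 0" using \<kappa>0 by (auto simp: C_def c_def less_max_iff_disj)
  ultimately show ?thesis using that by (simp add: \<sigma>_def)
qed

lemma bump_size_le:
  fixes M K R \<epsilon> n :: real and N w L k :: nat
  assumes pos: "N > 0" "w > 0" "L > 0" "R > 0" "k \<ge> 1" "\<epsilon> > 0" "K > 0" "M \<ge> 0" "n \<ge> 0"
    and wL: "K * R ^ (k - 1) \<le> real w ^ k * real L" and K: "M * n * 2 ^ k / \<epsilon> \<le> K"
  shows "M * (n / (real L * R)) / (real N * real w / (2 * R)) ^ k \<le> \<epsilon>"
proof -
  have "K * R ^ (k - 1) \<le> (real N * real w) ^ k * real L"
  proof -
    have "1 * real w \<le> real N * real w" using pos by (intro mult_right_mono) auto
    then have "real w ^ k * real L \<le> (real N * real w) ^ k * real L"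
      by (intro mult_right_mono power_mono) auto
    with wL show ?thesis by linarith
  qed
  then have "R ^ (k - 1) / ((real N * real w) ^ k * real L) \<le> 1 / K"
    using pos by (simp add: field_simps)
  then have "M * n * 2 ^ k * (R ^ (k - 1) / ((real N * real w) ^ k * real L))
      \<le> M * n * 2 ^ k * (1 / K)"
    using pos by (intro mult_left_mono) auto
  also have "\<dots> \<le> \<epsilon>" using K pos by (simp add: field_simps)
  finally have "M * n * 2 ^ k * (R ^ (k - 1) / ((real N * real w) ^ k * real L)) \<le> \<epsilon>" .
  moreover have "R ^ k = R * R ^ (k - 1)" using pos(5) by (simp add: power_eq_if)
  ultimately show ?thesis using pos by (simp add: power_divide power_mult_distrib field_simps)
qed

lemma small_shear_at_scale:
  fixes \<Sigma> :: "(real^'n::finite) set" and N w T L k :: nat and R \<rho> \<epsilon> K M :: real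
  assumes bump: "\<And>v. Ck_norm_le k (M * norm v) (\<lambda>x. cube_bump k I x *\<^sub>R (v :: real^'n))"
    and \<Sigma>: "compact \<Sigma>" "projects_onto_cube I c \<rho> \<Sigma>" and \<rho>: "\<rho> \<le> 1"
    and pos: "N > 0" "R > 0" and k: "k \<ge> 1" and \<epsilon>: "\<epsilon> > 0"
    and N: "2 * real CARD('n) ^ 2 \<le> \<epsilon> * real N" and R: "real CARD('n) \<le> \<epsilon> * R"
    and K: "K > 0" "M * real CARD('n) * 2 ^ k / \<epsilon> \<le> K"
    and scale: "admissible_scale \<rho> K N k (card I) (card (- I)) R w T L"
  obtains G where "shear_field I G" "Ck_norm_le k (3 * \<epsilon>) G"
    "real T ^ card I * real w ^ card I / (2 * real L ^ card (- I))
      \<le> real (card ((\<lambda>x. x + G x) ` \<Sigma> \<inter> scaled_lattice R))"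
proof -
  have wTL: "w > 0" "T > 0" "L > 0"
    and fits: "1 + 2 * real N * real w * real T \<le> R * \<rho>"
    and Lw: "2 * 9 ^ card (- I) * real w ^ card I \<le> real L ^ card (- I)"
    and wL: "K * R ^ (k - 1) \<le> real w ^ k * real L"
    using scale by (auto simp: admissible_scale_def)
  define n where "n = real CARD('n)"
  have n: "n > 0" by (simp add: n_def)
  define \<alpha> where "\<alpha> = \<epsilon> / n ^ 2"
  have \<alpha>: "\<alpha> > 0" "n ^ 2 * \<alpha> = \<epsilon>" using \<epsilon> n by (simp_all add: \<alpha>_def)
  have \<alpha>N: "2 \<le> \<alpha> * real N" using N n by (simp add: \<alpha>_def n_def field_simps)
  obtain G where G: "shear_field I G"
    "Ck_norm_le k (n / R + n ^ 2 * \<alpha> + M * (n / (real L * R)) / (real N * real w / (2 * R)) ^ k) G"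
    "real T ^ card I * real w ^ card I / (2 * real L ^ card (- I))
      \<le> real (card ((\<lambda>x. x + G x) ` \<Sigma> \<inter> scaled_lattice R))"
    unfolding n_def
    by (rule many_lattice_points_at_scale[OF bump \<Sigma> \<rho> pos(1) wTL pos(2) \<alpha>(1) \<alpha>N fits Lw])
  have "0 \<le> M" using bump by (rule Ck_norm_le_scaleR_bound_nonneg)
  then have "M * (n / (real L * R)) / (real N * real w / (2 * R)) ^ k \<le> \<epsilon>"
    using n by (intro bump_size_le[OF pos(1) wTL(1,3) pos(2) k \<epsilon> K(1) _ _ wL K(2)[folded n_def]])
        simp_all
  moreover have "n / R \<le> \<epsilon>" using R pos by (simp add: n_def field_simps)
  ultimately have "Ck_norm_le k (3 * \<epsilon>) G" using \<alpha>(2) by (intro Ck_norm_le_mono[OF G(2)]) simp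
  then show ?thesis using that G(1,3) by blast
qed

lemma small_shear_with_many_lattice_points:
  fixes \<Sigma> :: "(real^'n::finite) set" and k m :: nat
  assumes \<Sigma>: "compact \<Sigma>" "projects_onto_cube I b \<rho> \<Sigma>" and \<rho>: "0 < \<rho>" "\<rho> \<le> 1"
    and I: "card I = m" "m < CARD('n)" and k: "k \<ge> 1" and \<epsilon>: "\<epsilon> > 0"
  obtains C c :: real where "C > 0" "c > 0" "\<forall>R\<ge>C. \<exists>G. shear_field I G \<and> Ck_norm_le k (3 * \<epsilon>) G \<and>
    c * R powr (real m * real CARD('n) / (real m + real k * (real CARD('n) - real m)))
      \<le> real (card ((\<lambda>x. x + G x) ` \<Sigma> \<inter> scaled_lattice R))"
proof -
  define n where "n = real CARD('n)"
  define d where "d = card (- I)"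
  have d: "d \<ge> 1" "real d = n - real m"
    using I by (simp_all add: d_def n_def Compl_eq_Diff_UNIV card_Diff_subset)
  obtain M where bump: "\<forall>v. Ck_norm_le k (M * norm v) (\<lambda>x. cube_bump k I x *\<^sub>R (v :: real^'n))"
    by (rule Ck_norm_le_cube_bump)
  obtain N :: nat where "max 1 (2 * n ^ 2 / \<epsilon>) \<le> real N" using real_arch_simple by blast
  then have N0: "N > 0" and N\<epsilon>: "2 * n ^ 2 \<le> \<epsilon> * real N" using \<epsilon> by (auto simp: field_simps)
  define K where "K = max 1 (M * n * 2 ^ k / \<epsilon>)"
  have K: "K \<ge> 1" "K > 0" "M * n * 2 ^ k / \<epsilon> \<le> K" by (auto simp: K_def)
  have exponent: "real m * (real m + real d) / (real m + real k * real d)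
      = real m * n / (real m + real k * (n - real m))"
    by (simp add: d(2))
  obtain C c where C: "C > 0" and c: "c > 0"
    and scales: "\<forall>R\<ge>C. \<exists>w T L. admissible_scale \<rho> K N k m d R w T L \<and>
      c * R powr (real m * n / (real m + real k * (n - real m)))
          \<le> real T ^ m * real w ^ m / (2 * real L ^ d)"
    by (rule exists_admissible_scales[OF d(1) k \<rho>(1) N0 K(1), of m, unfolded exponent])
  have "\<exists>G. shear_field I G \<and> Ck_norm_le k (3 * \<epsilon>) G \<and>
      c * R powr (real m * n / (real m + real k * (n - real m)))
        \<le> real (card ((\<lambda>x. x + G x) ` \<Sigma> \<inter> scaled_lattice R))" if "R \<ge> max C (n / \<epsilon>)" for R
  proof -
    have "R \<ge> C" "R > 0" and R: "n \<le> \<epsilon> * R" using that C \<epsilon> by (auto simp: field_simps)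
    then obtain w T L where scale: "admissible_scale \<rho> K N k m d R w T L"
      and many: "c * R powr (real m * n / (real m + real k * (n - real m)))
        \<le> real T ^ m * real w ^ m / (2 * real L ^ d)"
      using scales by blast
    obtain G where "shear_field I G" "Ck_norm_le k (3 * \<epsilon>) G"
      "real T ^ m * real w ^ m / (2 * real L ^ d)
        \<le> real (card ((\<lambda>x. x + G x) ` \<Sigma> \<inter> scaled_lattice R))"
      by (rule small_shear_at_scale[OF bump[rule_format] \<Sigma> \<rho>(2) N0 \<open>R > 0\<close> k \<epsilon>,
            folded n_def d_def, unfolded I(1), OF N\<epsilon> R K(2,3) scale])
    then show ?thesis using many by (intro exI[of _ G]) linarith
  qed
  moreover have "max C (n / \<epsilon>) > 0" using C by simp
  ultimately show ?thesis using that c unfolding n_def by blast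
qed

theorem theorem6p4:
  fixes \<Sigma> :: "(real^'n::finite) set" and m k :: nat and \<epsilon> :: real
  assumes "CARD('n) \<ge> 2" and "1 \<le> m" and "m < CARD('n)" and "k \<ge> 2"
    and "compact \<Sigma>" and "\<Sigma> \<noteq> {}" and "Ck_submanifold k m \<Sigma>"
    and "\<epsilon> > 0"
  shows "\<exists>C c. C > 0 \<and> c > 0 \<and>
    (\<forall>R \<ge> C. \<exists>\<Sigma>' :: (real^'n) set. Ck_submanifold k m \<Sigma>' \<and> Ck_close k \<epsilon> \<Sigma> \<Sigma>' \<and>
       c * R powr (real m * real CARD('n) / (real m + real k * (real CARD('n) - real m)))
         \<le> real (card (\<Sigma>' \<inter> scaled_lattice R)))"
proof -
  have k: "k \<ge> 1" and \<epsilon>: "\<epsilon> / 4 > 0" using assms(4,8) by simp_all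
  obtain I :: "'n set" and b \<rho> where I: "card I = m"
    and \<rho>: "0 < \<rho>" "\<rho> \<le> 1" and cube: "projects_onto_cube I b \<rho> \<Sigma>"
    by (rule Ck_submanifold_projects_onto_cube[OF assms(7) k assms(6)])
  obtain C c where "C > 0" "c > 0" and "\<forall>R\<ge>C. \<exists>G. shear_field I G \<and> Ck_norm_le k (3 * (\<epsilon> / 4)) G \<and>
      c * R powr (real m * real CARD('n) / (real m + real k * (real CARD('n) - real m)))
        \<le> real (card ((\<lambda>x. x + G x) ` \<Sigma> \<inter> scaled_lattice R))"
    by (rule small_shear_with_many_lattice_points[OF assms(5) cube \<rho> I assms(3) k \<epsilon>])
  moreover have "Ck_submanifold k m ((\<lambda>x. x + G x) ` \<Sigma>) \<and> Ck_close k \<epsilon> \<Sigma> ((\<lambda>x. x + G x) ` \<Sigma>)"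
    if G: "shear_field I G" "Ck_norm_le k (3 * (\<epsilon> / 4)) G" for G
  proof
    have "Ck_diffeo_on k UNIV UNIV (\<lambda>x. x + G x)"
      using G by (intro Ck_diffeo_on_shear) (simp_all add: Ck_norm_le_def)
    then show "Ck_submanifold k m ((\<lambda>x. x + G x) ` \<Sigma>)" by (rule Ck_submanifold_image[OF assms(7)])
    show "Ck_close k \<epsilon> \<Sigma> ((\<lambda>x. x + G x) ` \<Sigma>)" using assms(8) by (intro Ck_close_shear[OF G]) simp
  qed
  ultimately show ?thesis by meson
qed

end
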